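(* Let $k \ge 5$ be an integer, and let $M_{k,2k-1}$ be the sparse paving matroid of rank $k$ on the ground set $E_k=\{1,\dots,2k-4\}\cup\{a,b,c\}$ (of size $2k-1$) constructed in the context. Then $$\widehat{\rho}(I(M_{k,2k-1}))= \frac{(k-1)^2}{2k-3}> \frac{k}{\widehat{\alpha}(I(M_{k,2k-1}))}.$$
   Context: Construction. Let $k\ge 5$, $[m]=\{1,\dots,m\}$, and $E_k=[2k-4]\cup\{a,b,c\}$ with $a,b,c$ three distinct extra elements. Let $\sigma=(1\,2\,\cdots\,2k-4)$ be the cyclic permutation of $[2k-4]$ and $\gamma=\sigma^2$, a permutation of order $k-2$. For $A\subseteq[2k-4]$ put $\gamma^i(A)=\{\gamma^i(x):x\in A\}$. Define $X_i=\gamma^i([k-3])$ for $0\le i\le k-3$, and $C_i=\{a,b\}\cup X_i$ for $0\le i\le k-3$, $C_{k-2}=\{c\}\cup\{2i-1 : i\in[k-2]\}$, $C_{k-1}=\{c\}\cup\{2i : i\in[k-2]\}$. Each $C_i$ has $k-1$ elements and $|C_i\cap C_j|\le k-3$ for $i\ne j$; hence the $(k-1)$-subsets of $E_k$ other than $C_0,\dots,C_{k-1}$ are the bases of a sparse paving matroid $N_{k-1,2k-1}$ of rank $k-1$ (with circuit-hyperplanes exactly $C_0,\dots,C_{k-1}$). The matroid $M_{k,2k-1}$ is the dual of $N_{k-1,2k-1}$, i.e. its bases are the complements in $E_k$ of the bases of $N_{k-1,2k-1}$. (A matroid of rank $r$ is paving if every circuit has size at least $r$; it is sparse paving if both it and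 its dual are paving.) Let $\mathbb{K}$ be a field, $S=\mathbb{K}[x_e : e\in E_k]$ the standard graded polynomial ring, and $x^U=\prod_{i\in U}x_i$ for $U\subseteq E_k$. For a squarefree monomial ideal $I\subseteq S$ and $s\ge 1$, the $s$-th symbolic power is $I^{(s)}=\bigcap_{P\in \mathrm{Min}(I)}P^s$, where $\mathrm{Min}(I)$ is the set of minimal primes of $I$. For a nonzero homogeneous ideal $I$, $\alpha(I)$ is the smallest degree of a nonzero homogeneous element of $I$; the Waldschmidt constant is $\widehat{\alpha}(I)=\lim_{s\to\infty}\alpha(I^{(s)})/s$. The asymptotic resurgence is $\widehat{\rho}(I)=\sup\{ s/r : s,r \text{ positive integers and } I^{(st)}\not\subseteq I^{rt}\text{ for all } t\gg 0\}$. For a matroid $M$ with set of bases $\mathcal{B}(M)$, the facet ideal is $I(M)=\langle x^B : B\in\mathcal{B}(M)\rangle$. *)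

theory Defs
  imports
    Complex_Main
    "HOL-Library.Poly_Mapping"
    "HOL-Library.Extended_Real"
    "HOL-Algebra.Ideal_Product"
    "HOL-Combinatorics.Cycles"
begin

section \<open>Matroids given by their bases\<close>

record 'a based_set =
  ground :: "'a set"
  bases :: "'a set set"

definition matroid :: "'a based_set \<Rightarrow> bool" where
  "matroid M \<longleftrightarrow> finite (ground M) \<and> bases M \<subseteq> Pow (ground M) \<and> bases M \<noteq> {} \<and>
     (\<forall>A\<in>bases M. \<forall>B\<in>bases M. \<forall>x\<in>A - B. \<exists>y\<in>B - A. insert y (A - {x}) \<in> bases M)"

definition indep :: "'a based_set \<Rightarrow> 'a set \<Rightarrow> bool" where
  "indep M X \<longleftrightarrow> (\<exists>B\<in>bases M. X \<subseteq> B)"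

definition circuit :: "'a based_set \<Rightarrow> 'a set \<Rightarrow> bool" where
  "circuit M C \<longleftrightarrow> C \<subseteq> ground M \<and> \<not> indep M C \<and> (\<forall>X. X \<subset> C \<longrightarrow> indep M X)"

definition dual :: "'a based_set \<Rightarrow> 'a based_set" where
  "dual M = \<lparr>ground = ground M, bases = (\<lambda>B. ground M - B) ` bases M\<rparr>"

text \<open>All bases of a matroid have the same size, namely its rank.\<close>

definition paving :: "'a based_set \<Rightarrow> bool" where
  "paving M \<longleftrightarrow> matroid M \<and> (\<forall>C B. circuit M C \<longrightarrow> B \<in> bases M \<longrightarrow> card B \<le> card C)"

definition sparse_paving :: "'a based_set \<Rightarrow> bool" where
  "sparse_paving M \<longleftrightarrow> paving M \<and> paving (dual M)"


section \<open>The matroids $N_{k-1,2k-1}$ and $M_{k,2k-1}$\<close>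

text \<open>\<open>Num i\<close> stands for the integer \<open>i\<close>; \<open>Pa\<close>, \<open>Pb\<close>, \<open>Pc\<close> are the extra elements
  $a$, $b$, $c$.\<close>

datatype elt = Num nat | Pa | Pb | Pc

definition E_set :: "nat \<Rightarrow> elt set" where
  "E_set k = Num ` {1..2*k-4} \<union> {Pa, Pb, Pc}"

definition sigma :: "nat \<Rightarrow> nat \<Rightarrow> nat" where
  "sigma k = cycle_of_list [1..<Suc (2*k-4)]"

definition gamma :: "nat \<Rightarrow> nat \<Rightarrow> nat" where
  "gamma k = sigma k ^^ 2"

definition X_set :: "nat \<Rightarrow> nat \<Rightarrow> nat set" where
  "X_set k i = (gamma k ^^ i) ` {1..k-3}"

definition C_set :: "nat \<Rightarrow> nat \<Rightarrow> elt set" where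
  "C_set k i =
    (if i \<le> k - 3 then {Pa, Pb} \<union> Num ` X_set k i
     else if i = k - 2 then {Pc} \<union> {Num (2*j-1) |j. j \<in> {1..k-2}}
     else {Pc} \<union> {Num (2*j) |j. j \<in> {1..k-2}})"

definition N_matroid :: "nat \<Rightarrow> elt based_set" where
  "N_matroid k = \<lparr>ground = E_set k,
     bases = {B. B \<subseteq> E_set k \<and> card B = k - 1 \<and> B \<notin> C_set k ` {0..k-1}}\<rparr>"

definition M_matroid :: "nat \<Rightarrow> elt based_set" where
  "M_matroid k = dual (N_matroid k)"


section \<open>Polynomial rings\<close>

type_synonym ('v, 'a) mpoly = "('v \<Rightarrow>\<^sub>0 nat) \<Rightarrow>\<^sub>0 'a"

text \<open>The polynomial ring over the field \<open>'a\<close> whose set of variables is \<open>V\<close>. A polynomial is a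
  finitely supported function from monomials to coefficients, and a monomial is a finitely
  supported function from variables to exponents.\<close>

definition poly_ring :: "'v set \<Rightarrow> ('v, 'a::field) mpoly ring" where
  "poly_ring V = \<lparr>carrier = {p. \<forall>m\<in>Poly_Mapping.keys p. Poly_Mapping.keys m \<subseteq> V},
     monoid.mult = (*), one = 1, zero = 0, add = (+)\<rparr>"

definition var :: "'v \<Rightarrow> ('v, 'a::field) mpoly" where
  "var v = Poly_Mapping.single (Poly_Mapping.single v 1) 1"

definition mono_degree :: "('v \<Rightarrow>\<^sub>0 nat) \<Rightarrow> nat" where
  "mono_degree m = (\<Sum>v\<in>Poly_Mapping.keys m. Poly_Mapping.lookup m v)"

definition homogeneous :: "nat \<Rightarrow> ('v, 'a::field) mpoly \<Rightarrow> bool" where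
  "homogeneous d p \<longleftrightarrow> (\<forall>m\<in>Poly_Mapping.keys p. mono_degree m = d)"

definition facet_ideal :: "'v based_set \<Rightarrow> ('v, 'a::field) mpoly set" where
  "facet_ideal M = Idl\<^bsub>poly_ring (ground M)\<^esub> ((\<lambda>B. \<Prod>v\<in>B. var v) ` bases M)"


section \<open>Powers, symbolic powers and asymptotic invariants of ideals\<close>

abbreviation ideal_power :: "('r, 'm) ring_scheme \<Rightarrow> 'r set \<Rightarrow> nat \<Rightarrow> 'r set" where
  "ideal_power R I s \<equiv> I [^]\<^bsub>ideals_set R\<^esub> s"

definition min_primes :: "('r, 'm) ring_scheme \<Rightarrow> 'r set \<Rightarrow> 'r set set" where
  "min_primes R I = {P. primeideal P R \<and> I \<subseteq> P \<and>
     (\<forall>Q. primeideal Q R \<longrightarrow> I \<subseteq> Q \<longrightarrow> Q \<subseteq> P \<longrightarrow> Q = P)}"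

text \<open>This formula is the definition for squarefree monomial ideals, where all associated primes
  are minimal and their ordinary powers are primary. Intersecting with the carrier only
  matters when there is no minimal prime, i.e. for the unit ideal.\<close>

definition symbolic_power :: "('r, 'm) ring_scheme \<Rightarrow> 'r set \<Rightarrow> nat \<Rightarrow> 'r set" where
  "symbolic_power R I s = carrier R \<inter> (\<Inter>P\<in>min_primes R I. ideal_power R P s)"

definition alpha :: "('v, 'a::field) mpoly set \<Rightarrow> nat" where
  "alpha I = (LEAST d. \<exists>p\<in>I. p \<noteq> 0 \<and> homogeneous d p)"

definition waldschmidt :: "('v, 'a::field) mpoly ring \<Rightarrow> ('v, 'a) mpoly set \<Rightarrow> real" where
  "waldschmidt R I = lim (\<lambda>s. real (alpha (symbolic_power R I s)) / real s)"

text \<open>The supremum is taken in the extended reals, so that it is meaningful without a proof of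
  boundedness.\<close>

definition asymptotic_resurgence :: "('r, 'm) ring_scheme \<Rightarrow> 'r set \<Rightarrow> ereal" where
  "asymptotic_resurgence R I = Sup {ereal (real s / real r) |s r. s > 0 \<and> r > 0 \<and>
     (\<forall>\<^sub>F t in sequentially. \<not> symbolic_power R I (s * t) \<subseteq> ideal_power R I (r * t))}"


section \<open>The definitions above describe a ring and a sparse paving matroid\<close>

lemma cring_poly_ring: "cring (poly_ring V :: ('v, 'a::field) mpoly ring)"
proof -
  define P where "P p \<longleftrightarrow> (\<forall>m\<in>Poly_Mapping.keys p. Poly_Mapping.keys m \<subseteq> V)"
    for p :: "('v, 'a) mpoly"
  have R: "poly_ring V = \<lparr>carrier = Collect P, monoid.mult = (*), one = 1, zero = 0, add = (+)\<rparr>"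
    unfolding poly_ring_def P_def ..
  have plus: "P (p + q)" if "P p" "P q" for p q
    using that Poly_Mapping.keys_add[of p q] unfolding P_def by blast
  have times: "P (p * q)" if p: "P p" and q: "P q" for p q
    unfolding P_def
  proof
    fix m assume "m \<in> Poly_Mapping.keys (p * q)"
    then obtain a b where ab: "m = a + b" "a \<in> Poly_Mapping.keys p" "b \<in> Poly_Mapping.keys q"
      using Poly_Mapping.keys_mult[of p q] by blast
    moreover have "Poly_Mapping.keys a \<subseteq> V" "Poly_Mapping.keys b \<subseteq> V"
      using ab p q unfolding P_def by blast+
    ultimately show "Poly_Mapping.keys m \<subseteq> V"
      using Poly_Mapping.keys_add[of a b] by blast
  qed
  have zero: "P 0" and one: "P 1" and uminus: "P p \<Longrightarrow> P (- p)" for p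
    by (simp_all add: P_def)
  show ?thesis
    unfolding R
  proof (rule cringI)
    show "abelian_group \<lparr>carrier = Collect P, monoid.mult = (*), one = 1, zero = 0, add = (+)\<rparr>"
    proof (rule abelian_groupI, goal_cases)
      case (6 x)
      then show ?case using uminus[of x] by (intro bexI[of _ "- x"]) simp_all
    qed (simp_all add: plus zero add.assoc add.commute)
    show "comm_monoid \<lparr>carrier = Collect P, monoid.mult = (*), one = 1, zero = 0, add = (+)\<rparr>"
      by (rule comm_monoidI) (simp_all add: times one mult.assoc mult.commute)
  qed (simp add: distrib_right)
qed

lemma paving_family:
  fixes E :: "'a set" and Cs :: "'a set set" and r :: nat
  assumes fin: "finite E" and r: "1 \<le> r" "r < card E"
    and Cs: "\<And>C. C \<in> Cs \<Longrightarrow> C \<subseteq> E \<and> card C = r"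
    and sep: "\<And>C D. C \<in> Cs \<Longrightarrow> D \<in> Cs \<Longrightarrow> C \<noteq> D \<Longrightarrow> card (C \<inter> D) + 2 \<le> r"
  defines "M \<equiv> \<lparr>ground = E, bases = {B. B \<subseteq> E \<and> card B = r \<and> B \<notin> Cs}\<rparr>"
  shows "paving M"
proof -
  have ext: "insert y X \<in> bases M \<or> insert z X \<in> bases M"
    if X: "X \<subseteq> E" "card X = r - 1" and yz: "y \<in> E - X" "z \<in> E - X" "y \<noteq> z" for X y z
  proof -
    have fX: "finite X" using X fin finite_subset by blast
    have cards: "card (insert y X) = r" "card (insert z X) = r"
      using yz X r fX by auto
    have int: "insert y X \<inter> insert z X = X" using yz by auto
    have "insert y X \<noteq> insert z X" using yz by auto
    then have "\<not> (insert y X \<in> Cs \<and> insert z X \<in> Cs)"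
      using sep[of "insert y X" "insert z X"] int X r by auto
    then show ?thesis using cards X yz by (auto simp: M_def)
  qed
  have two: "\<exists>y z. y \<in> A \<and> z \<in> A \<and> y \<noteq> z" if "card A \<ge> 2" for A :: "'a set"
  proof -
    obtain T where "T \<subseteq> A" "card T = 2" using obtain_subset_with_card_n[OF \<open>card A \<ge> 2\<close>] by metis
    then show ?thesis by (metis card_2_iff insert_subset)
  qed
  have small: "indep M X" if X: "X \<subseteq> E" "card X < r" for X
  proof -
    have "\<exists>Y. X \<subseteq> Y \<and> Y \<subseteq> E \<and> card Y = r - 1"
      using exists_subset_between[of X "r - 1" E] X r fin by auto
    then obtain Y where Y: "X \<subseteq> Y" "Y \<subseteq> E" "card Y = r - 1" by blast
    have "card (E - Y) \<ge> 2"
      using Y r fin card_Diff_subset[of Y E] finite_subset[of Y E] by auto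
    then obtain y z where "y \<in> E - Y" "z \<in> E - Y" "y \<noteq> z" using two by metis
    then have "insert y Y \<in> bases M \<or> insert z Y \<in> bases M" using ext Y by blast
    then show ?thesis using Y unfolding indep_def by blast
  qed
  have "indep M {}" using small[of "{}"] r by simp
  then have ne: "bases M \<noteq> {}" unfolding indep_def by blast
  have exch: "\<exists>y\<in>B - A. insert y (A - {x}) \<in> bases M"
    if A: "A \<in> bases M" and B: "B \<in> bases M" and x: "x \<in> A - B" for A B x
  proof -
    have AB: "A \<subseteq> E" "B \<subseteq> E" "card A = r" "card B = r" "finite A" "finite B"
      using A B fin finite_subset by (auto simp: M_def)
    have cA: "card (A - {x}) = r - 1" using AB x by auto
    have ceq: "card (B - A) = card (A - B)"
      using AB by (simp add: card_Diff_subset_Int Int_commute)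
    have "card (A - B) \<noteq> 0" using x AB by auto
    then consider "card (B - A) = 1" | "card (B - A) \<ge> 2" using ceq by linarith
    then show ?thesis
    proof cases
      case 1
      then obtain y where y: "B - A = {y}" by (auto simp: card_1_singleton_iff)
      obtain x' where "A - B = {x'}" using 1 ceq by (metis card_1_singletonE)
      then have "A - B = {x}" using x by auto
      then have "insert y (A - {x}) = B" using y by auto
      then show ?thesis using y B by auto
    next
      case 2
      then obtain y z where yz: "y \<in> B - A" "z \<in> B - A" "y \<noteq> z" using two by metis
      have "insert y (A - {x}) \<in> bases M \<or> insert z (A - {x}) \<in> bases M"
        by (rule ext) (use yz AB cA in auto)
      then show ?thesis using yz by blast
    qed
  qed
  have "matroid M"
    unfolding matroid_def using ne exch fin by (auto simp: M_def)
  moreover have "card B \<le> card C" if "circuit M C" "B \<in> bases M" for B C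
    using that small[of C] unfolding circuit_def by (force simp: M_def)
  ultimately show ?thesis unfolding paving_def by blast
qed

lemma sparse_paving_dual_family:
  fixes E :: "'a set" and Cs :: "'a set set" and r :: nat
  assumes fin: "finite E" and r: "1 \<le> r" "r < card E"
    and Cs: "\<And>C. C \<in> Cs \<Longrightarrow> C \<subseteq> E \<and> card C = r"
    and sep: "\<And>C D. C \<in> Cs \<Longrightarrow> D \<in> Cs \<Longrightarrow> C \<noteq> D \<Longrightarrow> card (C \<inter> D) + 2 \<le> r"
  defines "M \<equiv> \<lparr>ground = E, bases = {B. B \<subseteq> E \<and> card B = r \<and> B \<notin> Cs}\<rparr>"
  shows "sparse_paving (dual M)"
proof -
  let ?Ds = "(\<lambda>C. E - C) ` Cs"
  have compl: "card (E - B) = card E - card B \<and> card B \<le> card E" if "B \<subseteq> E" for B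
    using that fin by (auto simp: card_Diff_subset finite_subset card_mono)
  have bd: "(\<lambda>B. E - B) ` bases M = {B. B \<subseteq> E \<and> card B = card E - r \<and> B \<notin> ?Ds}"
  proof (intro equalityI subsetI)
    fix B assume "B \<in> (\<lambda>B. E - B) ` bases M"
    then obtain A where A: "A \<subseteq> E" "card A = r" "A \<notin> Cs" "B = E - A" by (auto simp: M_def)
    have "B \<notin> ?Ds"
    proof
      assume "B \<in> ?Ds"
      then obtain C where "C \<in> Cs" "E - A = E - C" using A by auto
      moreover from this have "C = A" using A(1) Cs by blast
      ultimately show False using A by blast
    qed
    then show "B \<in> {B. B \<subseteq> E \<and> card B = card E - r \<and> B \<notin> ?Ds}"
      using A compl[of A] by simp
  next
    fix B assume "B \<in> {B. B \<subseteq> E \<and> card B = card E - r \<and> B \<notin> ?Ds}"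
    then have B: "B \<subseteq> E" "card B = card E - r" "B \<notin> ?Ds" by auto
    have BE: "B = E - (E - B)" using B by auto
    have "card (E - B) = r" using B compl[of B] r by simp
    moreover have "E - B \<notin> Cs" using B(3) BE by blast
    ultimately have "E - B \<in> bases M" by (simp add: M_def)
    then show "B \<in> (\<lambda>B. E - B) ` bases M" using BE by blast
  qed
  have dM: "dual M = \<lparr>ground = E, bases = {B. B \<subseteq> E \<and> card B = card E - r \<and> B \<notin> ?Ds}\<rparr>"
    unfolding dual_def using bd by (simp add: M_def)
  have "paving (dual M)"
    unfolding dM
  proof (rule paving_family[OF fin])
    show "D \<subseteq> E \<and> card D = card E - r" if "D \<in> ?Ds" for D
      using that Cs compl by auto
    show "card (D \<inter> D') + 2 \<le> card E - r"
      if D: "D \<in> ?Ds" "D' \<in> ?Ds" "D \<noteq> D'" for D D'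
    proof -
      obtain C C' where C: "C \<in> Cs" "C' \<in> Cs" "D = E - C" "D' = E - C'" using D by auto
      have "C \<noteq> C'" using C D by auto
      then have "card (C \<inter> C') + 2 \<le> r" using sep C by auto
      moreover have "card (C \<union> C') + card (C \<inter> C') = 2 * r"
        using card_Un_Int[of C C'] Cs[OF C(1)] Cs[OF C(2)] finite_subset[OF _ fin] by simp
      moreover have "D \<inter> D' = E - (C \<union> C')" using C by auto
      moreover have "card (E - (C \<union> C')) = card E - card (C \<union> C')" "card (C \<union> C') \<le> card E"
        using compl[of "C \<union> C'"] C Cs by auto
      moreover have "card C = r" "card C \<le> card E" using compl[of C] Cs[OF C(1)] by auto
      ultimately show ?thesis by simp
    qed
  qed (use r in auto)
  moreover have "dual (dual M) = M"
  proof -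
    have "(\<lambda>B. E - B) ` (\<lambda>B. E - B) ` bases M = bases M"
    proof -
      have "E - (E - B) = B" if "B \<in> bases M" for B using that by (auto simp: M_def)
      then show ?thesis by (force simp: image_image)
    qed
    then show ?thesis by (simp add: dual_def M_def)
  qed
  moreover have "paving M" unfolding M_def by (rule paving_family[OF fin r Cs sep])
  ultimately show ?thesis unfolding sparse_paving_def by simp
qed

lemma sigma_eq:
  assumes "x \<in> {1..2*k-4}"
  shows "sigma k x = x mod (2*k-4) + 1"
proof -
  let ?n = "2*k-4" and ?cs = "[1..<Suc (2*k-4)]"
  obtain y where y: "x = Suc y" "y < ?n" using assms by (cases x) auto
  have "map (sigma k) ?cs = rotate1 ?cs"
    using cyclic_rotation[of ?cs 1] by (simp add: sigma_def del: upt_Suc)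
  then have "map (sigma k) ?cs ! y = rotate1 ?cs ! y" by simp
  then have "sigma k x = ?cs ! (Suc y mod ?n)"
    using y nth_rotate1[of y ?cs] by (simp del: upt_Suc)
  also have "\<dots> = Suc y mod ?n + 1"
    using y mod_less_divisor[of ?n "Suc y"] by (subst nth_upt) linarith+
  finally show ?thesis using y by simp
qed

lemma gamma_pow_eq:
  assumes "x \<in> {1..2*k-4}"
  shows "(gamma k ^^ i) x = (x - 1 + 2 * i) mod (2*k-4) + 1"
proof -
  let ?n = "2*k-4"
  have n: "?n > 0" using assms by auto
  have *: "(sigma k ^^ j) x = (x - 1 + j) mod ?n + 1" for j
  proof (induction j)
    case 0
    then show ?case using assms by auto
  next
    case (Suc j)
    have "(x - 1 + j) mod ?n + 1 \<in> {1..?n}"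
      using mod_less_divisor[OF n, of "x - 1 + j"] by (simp del: mod_less_divisor)
    from sigma_eq[OF this] Suc show ?case by (simp add: mod_Suc_eq)
  qed
  have "gamma k ^^ i = sigma k ^^ (2 * i)"
    unfolding gamma_def by (simp add: funpow_mult)
  then show ?thesis using * by simp
qed

lemma gamma_pow_bij: "bij (gamma k ^^ i)"
proof -
  have "bij (sigma k)"
    unfolding sigma_def using cycle_permutes permutes_bij by blast
  then show ?thesis unfolding gamma_def by (simp add: bij_fn)
qed

lemma X_set_range:
  assumes "k \<ge> 5"
  shows "X_set k i \<subseteq> {1..2*k-4}" "card (X_set k i) = k - 3" "finite (X_set k i)"
proof -
  show "X_set k i \<subseteq> {1..2*k-4}"
  proof
    fix y assume "y \<in> X_set k i"
    then obtain x where x: "x \<in> {1..k-3}" "y = (gamma k ^^ i) x" unfolding X_set_def by auto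
    have "y = (x - 1 + 2 * i) mod (2*k-4) + 1" using gamma_pow_eq[of x k i] x assms by auto
    moreover have "(x - 1 + 2 * i) mod (2*k-4) < 2*k-4" using assms by simp
    ultimately show "y \<in> {1..2*k-4}" by auto
  qed
  have "inj_on (gamma k ^^ i) {1..k-3}"
    by (rule inj_on_subset[OF bij_is_inj[OF gamma_pow_bij] subset_UNIV])
  then show "card (X_set k i) = k - 3" unfolding X_set_def by (simp add: card_image)
  show "finite (X_set k i)" unfolding X_set_def by simp
qed

lemma X_set_Int:
  assumes k: "k \<ge> 5" and ij: "i < j" "j \<le> k - 3"
  shows "card (X_set k i \<inter> X_set k j) + 2 \<le> k - 3"
proof -
  define d where "d = j - i"
  have d: "1 \<le> d" "d \<le> k - 3" "j = i + d" using ij by (auto simp: d_def)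
  have inj: "inj (gamma k ^^ i)" using gamma_pow_bij bij_is_inj by blast
  have "X_set k j = (gamma k ^^ i) ` X_set k d"
    unfolding X_set_def d(3) by (simp add: funpow_add image_comp)
  then have "X_set k i \<inter> X_set k j = (gamma k ^^ i) ` ({1..k-3} \<inter> X_set k d)"
    using image_Int[OF inj] unfolding X_set_def by simp
  then have c: "card (X_set k i \<inter> X_set k j) = card ({1..k-3} \<inter> X_set k d)"
    using inj by (simp add: card_image inj_on_subset)
  have mem: "(2 * d \<le> y - 1 \<and> y - 1 < 2 * d + (k - 3)) \<or> y - 1 + (2*k-4) < 2 * d + (k - 3)"
    if y: "y \<in> X_set k d" for y
  proof -
    obtain x where x: "x \<in> {1..k-3}" "y = (gamma k ^^ d) x" using y unfolding X_set_def by auto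
    have yx: "y - 1 = (x - 1 + 2 * d) mod (2*k-4)" using gamma_pow_eq[of x k d] x k by auto
    show ?thesis
    proof (cases "x - 1 + 2 * d < 2*k-4")
      case True
      then have "y - 1 = x - 1 + 2 * d" using yx by simp
      then show ?thesis using x by auto
    next
      case False
      then have "(x - 1 + 2 * d) mod (2*k-4) = x - 1 + 2 * d - (2*k-4)"
        using x d k by (subst le_mod_geq) auto
      then show ?thesis using yx x d k False by auto
    qed
  qed
  have "\<exists>u. u \<in> {1..k-3} \<and> u + 1 \<in> {1..k-3} \<and> u \<notin> X_set k d \<and> u + 1 \<notin> X_set k d"
  proof (cases "2 * d < k")
    case True
    have "1 \<notin> X_set k d" "1 + 1 \<notin> X_set k d"
      using mem[of 1] mem[of "1 + 1"] d k True by auto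
    then show ?thesis using k by (intro exI[of _ 1]) auto
  next
    case False
    have "k - 4 \<notin> X_set k d" "k - 4 + 1 \<notin> X_set k d"
      using mem[of "k - 4"] mem[of "k - 4 + 1"] d k False by auto
    then show ?thesis using k by (intro exI[of _ "k - 4"]) auto
  qed
  then obtain u where u: "u \<in> {1..k-3}" "u + 1 \<in> {1..k-3}" "u \<notin> X_set k d" "u + 1 \<notin> X_set k d"
    by blast
  have "{1..k-3} \<inter> X_set k d \<subseteq> {1..k-3} - {u, u + 1}" using u by auto
  then have "card ({1..k-3} \<inter> X_set k d) \<le> card ({1..k-3} - {u, u + 1})"
    by (intro card_mono) auto
  also have "\<dots> = k - 3 - 2" using u by (subst card_Diff_subset) auto
  finally have "card ({1..k-3} \<inter> X_set k d) \<le> k - 3 - 2" .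
  moreover have "k - 3 \<ge> 2" using k by simp
  ultimately show ?thesis using c by simp
qed

lemma C_set_card:
  assumes k: "k \<ge> 5" and i: "i \<le> k - 1"
  shows "C_set k i \<subseteq> E_set k \<and> card (C_set k i) = k - 1"
proof -
  consider "i \<le> k - 3" | "i = k - 2" | "i = k - 1" using i by linarith
  then show ?thesis
  proof cases
    case 1
    have "card ({Pa, Pb} \<union> Num ` X_set k i) = 2 + (k - 3)"
      using X_set_range[OF k, of i]
      by (subst card_Un_disjoint) (auto simp: card_image inj_on_def)
    moreover have "Num ` X_set k i \<subseteq> E_set k" using X_set_range[OF k, of i] by (auto simp: E_set_def)
    ultimately show ?thesis using 1 k by (auto simp: C_set_def E_set_def)
  next
    case 2
    have eq: "{Num (2*j-1) |j. j \<in> {1..k-2}} = (\<lambda>j. Num (2*j-1)) ` {1..k-2}" by auto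
    have "inj_on (\<lambda>j. Num (2*j-1)) {1..k-2}"
      by (rule inj_onI) auto
    from card_image[OF this] have "card ({Pc} \<union> (\<lambda>j. Num (2*j-1)) ` {1..k-2}) = 1 + (k - 2)"
      by (subst card_Un_disjoint) auto
    moreover have "Num (2*j-1) \<in> E_set k" if "j \<in> {1..k-2}" for j
      unfolding E_set_def using that by (intro UnI1 imageI) auto
    moreover have "C_set k i = {Pc} \<union> (\<lambda>j. Num (2*j-1)) ` {1..k-2}"
      unfolding C_set_def eq using 2 k by simp
    moreover have "Pc \<in> E_set k" by (simp add: E_set_def)
    ultimately show ?thesis using k by auto
  next
    case 3
    have eq: "{Num (2*j) |j. j \<in> {1..k-2}} = (\<lambda>j. Num (2*j)) ` {1..k-2}" by auto
    have "inj_on (\<lambda>j. Num (2*j)) {1..k-2}"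
      by (rule inj_onI) auto
    from card_image[OF this] have "card ({Pc} \<union> (\<lambda>j. Num (2*j)) ` {1..k-2}) = 1 + (k - 2)"
      by (subst card_Un_disjoint) auto
    moreover have "Num (2*j) \<in> E_set k" if "j \<in> {1..k-2}" for j
      unfolding E_set_def using that by (intro UnI1 imageI) auto
    moreover have "C_set k i = {Pc} \<union> (\<lambda>j. Num (2*j)) ` {1..k-2}"
      unfolding C_set_def eq using 3 k by simp linarith
    moreover have "Pc \<in> E_set k" by (simp add: E_set_def)
    ultimately show ?thesis using k by auto
  qed
qed

lemma C_set_Int:
  assumes k: "k \<ge> 5" and ij: "i < j" "j \<le> k - 1"
  shows "card (C_set k i \<inter> C_set k j) + 2 \<le> k - 1"
proof -
  consider "j \<le> k - 3" | "i \<le> k - 3" "k - 2 \<le> j" | "i = k - 2" "j = k - 1"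
    using ij by linarith
  then show ?thesis
  proof cases
    case 1
    have "C_set k i \<inter> C_set k j = {Pa, Pb} \<union> Num ` (X_set k i \<inter> X_set k j)"
      using 1 ij by (auto simp: C_set_def)
    moreover have "card ({Pa, Pb} \<union> Num ` (X_set k i \<inter> X_set k j)) = 2 + card (X_set k i \<inter> X_set k j)"
      using X_set_range[OF k] by (subst card_Un_disjoint) (auto simp: card_image inj_on_def)
    ultimately show ?thesis using X_set_Int[OF k ij(1) 1] by simp
  next
    case 2
    have "C_set k i \<inter> C_set k j \<subseteq> Num ` X_set k i"
      using 2 ij k by (auto simp: C_set_def)
    then have "card (C_set k i \<inter> C_set k j) \<le> card (X_set k i)"
      using X_set_range[OF k, of i] by (metis card_image_le card_mono finite_imageI le_trans)
    then show ?thesis using X_set_range[OF k, of i] k by simp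
  next
    case 3
    have "C_set k i \<inter> C_set k j \<subseteq> {Pc}"
      using 3 k by (auto simp: C_set_def) presburger+
    then have "card (C_set k i \<inter> C_set k j) \<le> 1"
      using card_mono[of "{Pc}"] by fastforce
    then show ?thesis using k by simp
  qed
qed

lemma card_E_set:
  assumes "k \<ge> 5"
  shows "finite (E_set k) \<and> card (E_set k) = 2 * k - 1"
proof -
  have "card (Num ` {1..2*k-4}) = 2 * k - 4"
    by (simp add: card_image inj_on_def)
  moreover have "Num ` {1..2*k-4} \<inter> {Pa, Pb, Pc} = {}" by blast
  moreover have "card {Pa, Pb, Pc} = 3" by simp
  ultimately show ?thesis
    using assms unfolding E_set_def by (simp only: card_Un_disjoint finite_Un finite_imageI
      finite_atLeastAtMost finite.intros simp_thms)
qed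

theorem M_matroid_sparse_paving:
  assumes k: "k \<ge> 5"
  shows "sparse_paving (M_matroid k)" "\<And>B. B \<in> bases (M_matroid k) \<Longrightarrow> card B = k"
    "card (ground (M_matroid k)) = 2 * k - 1"
proof -
  have C_range: "C \<subseteq> E_set k \<and> card C = k - 1" if C: "C \<in> C_set k ` {0..k-1}" for C
  proof -
    obtain i where "i \<le> k - 1" "C = C_set k i" using C by (metis atLeastAtMost_iff imageE)
    then show ?thesis using C_set_card[OF k, of i] by simp
  qed
  have C_sep: "card (C \<inter> D) + 2 \<le> k - 1"
    if C: "C \<in> C_set k ` {0..k-1}" and D: "D \<in> C_set k ` {0..k-1}" and CD: "C \<noteq> D" for C D
  proof -
    obtain i where i: "i \<le> k - 1" "C = C_set k i" using C by (metis atLeastAtMost_iff imageE)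
    obtain j where j: "j \<le> k - 1" "D = C_set k j" using D by (metis atLeastAtMost_iff imageE)
    have "i \<noteq> j" using CD i(2) j(2) by metis
    then consider "i < j" | "j < i" by linarith
    then show ?thesis
    proof cases
      case 1
      from C_set_Int[OF k this j(1)] show ?thesis unfolding i(2) j(2) .
    next
      case 2
      from C_set_Int[OF k this i(1)] show ?thesis unfolding i(2) j(2) by (simp only: Int_commute)
    qed
  qed
  have "finite (E_set k)" "1 \<le> k - 1" "k - 1 < card (E_set k)"
    using card_E_set[OF k] k by simp_all
  from sparse_paving_dual_family[OF this C_range C_sep] show "sparse_paving (M_matroid k)"
    unfolding M_matroid_def N_matroid_def .
  show "card B = k" if "B \<in> bases (M_matroid k)" for B
  proof -
    obtain A where A: "A \<subseteq> E_set k" "card A = k - 1" "B = E_set k - A"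
      using \<open>B \<in> bases (M_matroid k)\<close> by (auto simp: M_matroid_def N_matroid_def dual_def)
    then show ?thesis
      using card_E_set[OF k] k by (simp add: card_Diff_subset finite_subset)
  qed
  show "card (ground (M_matroid k)) = 2 * k - 1"
    using card_E_set[OF k] by (simp add: M_matroid_def N_matroid_def dual_def)
qed

end

theory Submission
  imports Defs "HOL-Library.Multiset"
begin

text \<open>
  The minimal primes of a facet ideal are generated by the minimal vertex covers of the bases, so a
  monomial \<open>m\<close> lies in the \<open>s\<close>-th symbolic power iff \<open>m(C_i) \<ge> s\<close> for all \<open>i\<close> and
  \<open>m(U) \<ge> s\<close> for all \<open>k\<close>-subsets \<open>U\<close>, where \<open>m(U)\<close> is the total exponent on \<open>U\<close>. It lies in
  the \<open>q\<close>-th ordinary power iff \<open>q\<close> bases can be packed into \<open>m\<close>; this is possible as soon as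
  \<open>m(C_i) \<ge> q\<close> and \<open>m(T) \<ge> q (|T| - k + 1)\<close> whenever \<open>|T| \<ge> k\<close>: shrink \<open>m\<close> to total degree
  \<open>q k\<close>, write it as a sum of \<open>q\<close> arbitrary \<open>k\<close>-sets, and remove the nonbases by exchanges.
  Comparing the two descriptions, the worst \<open>T\<close> is the complement of \<open>a\<close>: every \<open>T\<close> with
  \<open>2k-2\<close> elements contains a circuit-hyperplane, hence \<open>m(T) \<ge> s (2k-3)/(k-1)\<close>, and equality is
  approached by the exponent \<open>0\<close> at \<open>b\<close>, a large one at \<open>a\<close> and \<open>s/(k-1)\<close> elsewhere. Averaging
  over the rotations gives \<open>m(E) \<ge> s (2k+1)/k\<close>, which is the Waldschmidt constant.
\<close>

section \<open>Monomial ideals and their powers\<close>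

text \<open>\<open>A\<close> is an arbitrary set of exponent vectors, so that sets such as sums of
  two such sets can be inserted as they stand; closure under multiplication by monomials enters only
  where the ideal property is derived.\<close>

definition mono_ideal :: "'v set \<Rightarrow> ('v \<Rightarrow>\<^sub>0 nat) set \<Rightarrow> ('v, 'a::field) mpoly set" where
  "mono_ideal V A = {p. \<forall>m\<in>Poly_Mapping.keys p. Poly_Mapping.keys m \<subseteq> V \<and> m \<in> A}"

lemma poly_ring_simps [simp]:
  "carrier (poly_ring V) = {p. \<forall>m\<in>Poly_Mapping.keys p. Poly_Mapping.keys m \<subseteq> V}"
  "x \<otimes>\<^bsub>poly_ring V\<^esub> y = x * y" "\<one>\<^bsub>poly_ring V\<^esub> = 1"
  "\<zero>\<^bsub>poly_ring V\<^esub> = 0" "x \<oplus>\<^bsub>poly_ring V\<^esub> y = x + y"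
  by (simp_all add: poly_ring_def)

lemma keys_add_nat:
  "Poly_Mapping.keys (a + b) = Poly_Mapping.keys a \<union> Poly_Mapping.keys (b :: 'v \<Rightarrow>\<^sub>0 nat)"
  by (auto simp: in_keys_iff lookup_add)

lemma poly_mapping_sum_single:
  "p = (\<Sum>m\<in>Poly_Mapping.keys p. Poly_Mapping.single m (Poly_Mapping.lookup p m))"
  by (rule poly_mapping_eqI) (auto simp: lookup_sum lookup_single when_def in_keys_iff sum.delta)

lemma ideal_poly_ringI:
  fixes J :: "('v, 'a::field) mpoly set"
  assumes "J \<subseteq> carrier (poly_ring V)" "0 \<in> J"
    and add: "\<And>p q. p \<in> J \<Longrightarrow> q \<in> J \<Longrightarrow> p + q \<in> J"
    and mult: "\<And>p q. p \<in> J \<Longrightarrow> q \<in> carrier (poly_ring V) \<Longrightarrow> p * q \<in> J"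
  shows "ideal J (poly_ring V)"
proof -
  interpret R: cring "poly_ring V :: ('v, 'a) mpoly ring" by (rule cring_poly_ring)
  show ?thesis
  proof (rule idealI)
    show "subgroup J (add_monoid (poly_ring V))"
    proof (rule R.add.subgroupI)
      fix p assume p: "p \<in> J"
      have "p * (- 1) \<in> J" by (rule mult[OF p]) simp
      moreover have "\<ominus>\<^bsub>poly_ring V\<^esub> p = - p"
        using p assms(1) by (intro R.minus_equality) auto
      ultimately show "\<ominus>\<^bsub>poly_ring V\<^esub> p \<in> J"
        by simp
    qed (use assms in auto)
  qed (use mult R.ring_axioms mult.commute in \<open>auto simp: mult.commute\<close>)
qed

lemma ideal_mono_ideal:
  fixes A :: "('v \<Rightarrow>\<^sub>0 nat) set"
  assumes "\<And>m n. m \<in> A \<Longrightarrow> Poly_Mapping.keys m \<subseteq> V \<Longrightarrow> Poly_Mapping.keys n \<subseteq> V \<Longrightarrow> m + n \<in> A"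
  shows "ideal (mono_ideal V A :: ('v, 'a::field) mpoly set) (poly_ring V)"
proof (rule ideal_poly_ringI)
  fix p q :: "('v, 'a) mpoly"
  show "p + q \<in> mono_ideal V A" if "p \<in> mono_ideal V A" "q \<in> mono_ideal V A"
    using that keys_add[of p q] by (auto simp: mono_ideal_def)
  show "p * q \<in> mono_ideal V A" if "p \<in> mono_ideal V A" "q \<in> carrier (poly_ring V)"
    using that keys_mult[of p q] assms
    by (fastforce simp: mono_ideal_def keys_add_nat)
qed (auto simp: mono_ideal_def)

lemma ideal_poly_ring_closed:
  fixes J :: "('v, 'a::field) mpoly set"
  assumes "ideal J (poly_ring V)"
  shows "0 \<in> J" "p \<in> J \<Longrightarrow> q \<in> J \<Longrightarrow> p + q \<in> J"
    "p \<in> J \<Longrightarrow> q \<in> carrier (poly_ring V) \<Longrightarrow> p * q \<in> J"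
    "p \<in> J \<Longrightarrow> q \<in> carrier (poly_ring V) \<Longrightarrow> q * p \<in> J"
  using additive_subgroup.zero_closed[OF ideal.axioms(1)[OF assms]]
    additive_subgroup.a_closed[OF ideal.axioms(1)[OF assms], of p q]
    ideal.I_r_closed[OF assms, of p q] ideal.I_l_closed[OF assms, of p q]
  by (simp_all del: poly_ring_simps(1))

text \<open>A polynomial is the sum of its terms, so closure under addition reduces the inclusion to
  single terms.\<close>

lemma mono_ideal_subsetI:
  fixes J :: "('v, 'a::field) mpoly set"
  assumes J: "\<And>p q. p \<in> J \<Longrightarrow> q \<in> J \<Longrightarrow> p + q \<in> J" "0 \<in> J"
    and s: "\<And>m c. m \<in> A \<Longrightarrow> Poly_Mapping.keys m \<subseteq> V \<Longrightarrow> Poly_Mapping.single m c \<in> J"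
  shows "mono_ideal V A \<subseteq> J"
proof
  fix p :: "('v, 'a) mpoly" assume p: "p \<in> mono_ideal V A"
  have "(\<Sum>m\<in>X. Poly_Mapping.single m (Poly_Mapping.lookup p m)) \<in> J"
    if "finite X" "X \<subseteq> Poly_Mapping.keys p" for X
    using that by (induction X rule: finite_induct)
      (use p in \<open>auto intro!: J s simp: mono_ideal_def\<close>)
  then show "p \<in> J" using poly_mapping_sum_single[of p] by (metis finite_keys subset_refl)
qed

lemma mono_ideal_cong:
  assumes "\<And>m. Poly_Mapping.keys m \<subseteq> V \<Longrightarrow> m \<in> A \<longleftrightarrow> m \<in> B"
  shows "mono_ideal V A = mono_ideal V B"
  using assms unfolding mono_ideal_def by blast

lemma mono_ideal_mono:
  assumes "\<And>m. m \<in> A \<Longrightarrow> Poly_Mapping.keys m \<subseteq> V \<Longrightarrow> m \<in> B"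
  shows "mono_ideal V A \<subseteq> mono_ideal V B"
  using assms unfolding mono_ideal_def by blast

lemma single_in_mono_ideal:
  assumes "c \<noteq> 0"
  shows "Poly_Mapping.single m c \<in> mono_ideal V A \<longleftrightarrow> Poly_Mapping.keys m \<subseteq> V \<and> m \<in> A"
  using assms by (auto simp: mono_ideal_def)

text \<open>The support of a product lies in the sum of the supports; conversely, a term with
  exponent \<open>a + b\<close> factors into a term with exponent \<open>a\<close> and the monic
  monomial of \<open>b\<close>.\<close>

lemma ideal_prod_mono_ideal:
  fixes A B :: "('v \<Rightarrow>\<^sub>0 nat) set"
  shows "ideal_prod (poly_ring V) (mono_ideal V A :: ('v, 'a::field) mpoly set) (mono_ideal V B) =
    mono_ideal V {a + b |a b. a \<in> A \<and> b \<in> B}"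
proof
  show "ideal_prod (poly_ring V) (mono_ideal V A :: ('v, 'a) mpoly set) (mono_ideal V B)
      \<subseteq> mono_ideal V {a + b |a b. a \<in> A \<and> b \<in> B}"
  proof
    fix p :: "('v, 'a) mpoly"
    assume "p \<in> ideal_prod (poly_ring V) (mono_ideal V A) (mono_ideal V B)"
    then show "p \<in> mono_ideal V {a + b |a b. a \<in> A \<and> b \<in> B}"
    proof induction
      case (prod p q)
      then show ?case using keys_mult[of p q]
        by (fastforce simp: mono_ideal_def keys_add_nat)
    next
      case (sum p q)
      then show ?case using keys_add[of p q] by (auto simp: mono_ideal_def)
    qed
  qed
  show "mono_ideal V {a + b |a b. a \<in> A \<and> b \<in> B}
      \<subseteq> ideal_prod (poly_ring V) (mono_ideal V A :: ('v, 'a) mpoly set) (mono_ideal V B)"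
  proof (rule mono_ideal_subsetI)
    fix p q :: "('v, 'a) mpoly"
    show "p + q \<in> ideal_prod (poly_ring V) (mono_ideal V A) (mono_ideal V B)"
      if "p \<in> ideal_prod (poly_ring V) (mono_ideal V A) (mono_ideal V B)"
        "q \<in> ideal_prod (poly_ring V) (mono_ideal V A) (mono_ideal V B)"
      using ideal_prod.sum[OF that] by simp
  next
    have "0 \<in> mono_ideal V A" "0 \<in> mono_ideal V B" by (auto simp: mono_ideal_def)
    from ideal_prod.prod[OF this, of "poly_ring V"]
    show "(0 :: ('v, 'a) mpoly) \<in> ideal_prod (poly_ring V) (mono_ideal V A) (mono_ideal V B)"
      by simp
  next
    fix m :: "'v \<Rightarrow>\<^sub>0 nat" and c :: 'a
    assume "m \<in> {a + b |a b. a \<in> A \<and> b \<in> B}" and m: "Poly_Mapping.keys m \<subseteq> V"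
    then obtain a b where ab: "m = a + b" "a \<in> A" "b \<in> B" by auto
    have "Poly_Mapping.single a c \<in> mono_ideal V A"
      "Poly_Mapping.single b (1 :: 'a) \<in> mono_ideal V B"
      using ab m by (auto simp: mono_ideal_def keys_add_nat)
    from ideal_prod.prod[OF this, of "poly_ring V"]
    show "Poly_Mapping.single m c \<in> ideal_prod (poly_ring V) (mono_ideal V A) (mono_ideal V B)"
      by (simp add: ab mult_single)
  qed
qed

lemma ideal_power_0: "ideal_power R I 0 = carrier R"
  and ideal_power_Suc: "ideal_power R I (Suc n) = ideal_prod R (ideal_power R I n) I"
  by (simp_all add: nat_pow_def ideals_set_def)

text \<open>\<open>F n\<close> is a closed description of the exponents in the \<open>n\<close>-th
  power, verified by a recursion that splits off one factor from \<open>A\<close>.\<close>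

lemma ideal_power_mono_ideal:
  fixes A :: "('v \<Rightarrow>\<^sub>0 nat) set"
  assumes "\<And>m. Poly_Mapping.keys m \<subseteq> V \<Longrightarrow> m \<in> F 0"
    and "\<And>n m. Poly_Mapping.keys m \<subseteq> V \<Longrightarrow> m \<in> F (Suc n) \<longleftrightarrow> (\<exists>a\<in>F n. \<exists>b\<in>A. m = a + b)"
  shows "ideal_power (poly_ring V) (mono_ideal V A :: ('v, 'a::field) mpoly set) n = mono_ideal V (F n)"
proof (induction n)
  case 0
  show ?case unfolding ideal_power_0 using assms(1) by (auto simp: mono_ideal_def)
next
  case (Suc n)
  show ?case unfolding ideal_power_Suc Suc ideal_prod_mono_ideal
    by (rule mono_ideal_cong) (use assms(2) in auto)
qed

lemma ideal_power_mono:
  assumes "I \<subseteq> J"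
  shows "ideal_power R I n \<subseteq> ideal_power R J n"
proof (induction n)
  case (Suc n)
  have "p \<in> ideal_prod R (ideal_power R J n) J" if "p \<in> ideal_prod R (ideal_power R I n) I" for p
    using that by induction (use Suc assms in \<open>auto intro: ideal_prod.intros\<close>)
  then show ?case unfolding ideal_power_Suc by blast
qed (simp add: ideal_power_0)

section \<open>Monomial primes\<close>

abbreviation msum :: "('v \<Rightarrow>\<^sub>0 nat) \<Rightarrow> 'v set \<Rightarrow> nat" where
  "msum m T \<equiv> (\<Sum>v\<in>T. Poly_Mapping.lookup m v)"

lemma msum_add: "msum (a + b) T = msum a T + msum b T"
  by (simp add: lookup_add sum.distrib)

text \<open>The ideal generated by the variables from \<open>T\<close> that belong to
  \<open>V\<close>, written through its monomials so that its powers can be computed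
  combinatorially.\<close>

definition var_prime :: "'v set \<Rightarrow> 'v set \<Rightarrow> ('v, 'a::field) mpoly set" where
  "var_prime V T = mono_ideal V {m. \<exists>v\<in>T. Poly_Mapping.lookup m v > 0}"

lemma ideal_var_prime: "ideal (var_prime V T :: ('v, 'a::field) mpoly set) (poly_ring V)"
  unfolding var_prime_def by (rule ideal_mono_ideal) (auto simp: lookup_add)

lemma split_off_single:
  fixes m :: "'v \<Rightarrow>\<^sub>0 nat"
  assumes "Poly_Mapping.lookup m v > 0"
  shows "m = (m - Poly_Mapping.single v 1) + Poly_Mapping.single v 1"
  using assms by (intro poly_mapping_eqI) (auto simp: lookup_add lookup_minus lookup_single when_def)

text \<open>A monomial of degree at least \<open>n + 1\<close> in the variables of \<open>T\<close>
  still has degree at least \<open>n\<close> after one such variable is removed, and each factor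
  from the prime adds at least one to this degree.\<close>

lemma ideal_power_var_prime:
  assumes T: "finite T"
  shows "ideal_power (poly_ring V) (var_prime V T :: ('v, 'a::field) mpoly set) s =
    mono_ideal V {m. s \<le> msum m T}"
  unfolding var_prime_def
proof (rule ideal_power_mono_ideal[where F = "\<lambda>s. {m. s \<le> msum m T}"], goal_cases)
  case (2 n m)
  show ?case
  proof
    assume "m \<in> {m. Suc n \<le> msum m T}"
    then have s: "Suc n \<le> msum m T" by simp
    then have "msum m T \<noteq> 0" by linarith
    then obtain v where v: "v \<in> T" "Poly_Mapping.lookup m v > 0"
      using T by auto
    let ?e = "Poly_Mapping.single v (1::nat)"
    note m = split_off_single[OF v(2)]
    have "msum m T = msum (m - ?e) T + msum ?e T"
      by (metis m msum_add)
    moreover have "msum ?e T = 1" using v T by (simp add: lookup_single when_def)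
    ultimately have "m - ?e \<in> {m. n \<le> msum m T}" using s by simp
    moreover have "?e \<in> {m. \<exists>v\<in>T. Poly_Mapping.lookup m v > 0}"
      using v by (auto intro!: bexI[of _ v])
    ultimately show "\<exists>a\<in>{m. n \<le> msum m T}. \<exists>b\<in>{m. \<exists>v\<in>T. Poly_Mapping.lookup m v > 0}. m = a + b"
      using m by blast
  next
    assume "\<exists>a\<in>{m. n \<le> msum m T}. \<exists>b\<in>{m. \<exists>v\<in>T. Poly_Mapping.lookup m v > 0}. m = a + b"
    then obtain a b v where ab: "m = a + b" "n \<le> msum a T" "v \<in> T" "Poly_Mapping.lookup b v > 0"
      by auto
    have "Poly_Mapping.lookup b v \<le> msum b T" using ab T by (intro member_le_sum) auto
    then show "m \<in> {m. Suc n \<le> msum m T}" using ab by (simp add: msum_add)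
  qed
qed auto

text \<open>Split both factors into a part free of the variables in \<open>T\<close> and a part
  inside the ideal. If the product lies in the ideal, the product of the two free parts is both free
  of \<open>T\<close> and in the ideal, hence zero, and the polynomial ring is a domain.\<close>

lemma primeideal_var_prime:
  fixes V :: "'v::linorder set"
  shows "primeideal (var_prime V T :: ('v, 'a::field) mpoly set) (poly_ring V)"
proof (rule primeidealI)
  show I: "ideal (var_prime V T :: ('v, 'a) mpoly set) (poly_ring V)" by (rule ideal_var_prime)
  show "cring (poly_ring V :: ('v, 'a) mpoly ring)" by (rule cring_poly_ring)
  have "(1 :: ('v, 'a) mpoly) \<notin> var_prime V T" by (auto simp: var_prime_def mono_ideal_def)
  moreover have "(1 :: ('v, 'a) mpoly) \<in> carrier (poly_ring V)" by simp
  ultimately show "carrier (poly_ring V) \<noteq> (var_prime V T :: ('v, 'a) mpoly set)" by blast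
  fix p q :: "('v, 'a) mpoly"
  assume pq: "p \<in> carrier (poly_ring V)" "q \<in> carrier (poly_ring V)"
    "p \<otimes>\<^bsub>poly_ring V\<^esub> q \<in> var_prime V T"
  let ?free = "{m. \<forall>v\<in>T. Poly_Mapping.lookup m v = (0::nat)}"
  have split: "\<exists>f g. p = f + g \<and> f \<in> mono_ideal V ?free \<and> g \<in> var_prime V T"
    if "p \<in> carrier (poly_ring V)" for p :: "('v, 'a) mpoly"
  proof -
    let ?s = "\<lambda>X. \<Sum>m\<in>X. Poly_Mapping.single m (Poly_Mapping.lookup p m)"
    let ?K = "Poly_Mapping.keys p"
    have "p = ?s ?K" by (rule poly_mapping_sum_single)
    also have "\<dots> = ?s (?K \<inter> ?free) + ?s (?K - ?free)"
      by (rule sum.Int_Diff) simp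
    finally have "p = ?s (?K \<inter> ?free) + ?s (?K - ?free)" .
    moreover have "Poly_Mapping.keys (?s X) \<subseteq> X" for X
      using Poly_Mapping.keys_sum[of _ X] by (fastforce split: if_splits)
    then have "?s (?K \<inter> ?free) \<in> mono_ideal V ?free" "?s (?K - ?free) \<in> var_prime V T"
      using that unfolding mono_ideal_def var_prime_def by fastforce+
    ultimately show ?thesis by blast
  qed
  obtain p0 p1 where p: "p = p0 + p1" "p0 \<in> mono_ideal V ?free" "p1 \<in> var_prime V T"
    using split[OF pq(1)] by blast
  obtain q0 q1 where q: "q = q0 + q1" "q0 \<in> mono_ideal V ?free" "q1 \<in> var_prime V T"
    using split[OF pq(2)] by blast
  have "p0 * q0 \<in> mono_ideal V ?free"
    using keys_mult[of p0 q0] p(2) q(2)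
    by (fastforce simp: mono_ideal_def keys_add_nat lookup_add)
  moreover have "p0 * q0 \<in> var_prime V T"
  proof -
    have c: "p0 \<in> carrier (poly_ring V)" using p by (auto simp: mono_ideal_def)
    have "p0 * q0 = p * q + (- (p0 * q1) + - (p1 * q))" unfolding p q by (simp add: algebra_simps)
    moreover have "p0 * q1 \<in> var_prime V T" "p1 * q \<in> var_prime V T"
      using ideal_poly_ring_closed(4)[OF I q(3) c] ideal_poly_ring_closed(3)[OF I p(3) pq(2)] .
    then have "- (p0 * q1) \<in> var_prime V T" "- (p1 * q) \<in> var_prime V T"
      by (simp_all add: var_prime_def mono_ideal_def in_keys_iff)
    moreover have "p * q \<in> var_prime V T" using pq(3) by simp
    ultimately show ?thesis using ideal_poly_ring_closed(2)[OF I] by metis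
  qed
  ultimately have "Poly_Mapping.keys (p0 * q0) = {}"
    unfolding mono_ideal_def var_prime_def by fastforce
  then have "p0 * q0 = 0" by simp
  then have "p0 = 0 \<or> q0 = 0" by simp
  then show "p \<in> var_prime V T \<or> q \<in> var_prime V T" using p q by auto
qed

lemma var_in_carrier: "v \<in> V \<Longrightarrow> var v \<in> carrier (poly_ring V)"
  by (auto simp: var_def)

lemma var_in_carrier_iff: "(var v :: ('v, 'a::field) mpoly) \<in> carrier (poly_ring V) \<longleftrightarrow> v \<in> V"
  by (auto simp: var_def)

lemma var_in_var_prime:
  "(var v :: ('v, 'a::field) mpoly) \<in> var_prime V T \<longleftrightarrow> v \<in> V \<inter> T"
  by (auto simp: var_prime_def mono_ideal_def var_def lookup_single when_def)

lemma var_prime_subset: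
  fixes Q :: "('v, 'a::field) mpoly set"
  assumes Q: "ideal Q (poly_ring V)" and T: "\<And>v. v \<in> T \<Longrightarrow> var v \<in> Q"
  shows "var_prime V T \<subseteq> Q"
  unfolding var_prime_def
proof -
  show "mono_ideal V {m. \<exists>v\<in>T. 0 < Poly_Mapping.lookup m v} \<subseteq> Q"
  proof (rule mono_ideal_subsetI)
    show "p + q \<in> Q" if "p \<in> Q" "q \<in> Q" for p q by (rule ideal_poly_ring_closed(2)[OF Q that])
    show "0 \<in> Q" by (rule ideal_poly_ring_closed(1)[OF Q])
    fix m :: "'v \<Rightarrow>\<^sub>0 nat" and c :: 'a
    assume "m \<in> {m. \<exists>v\<in>T. 0 < Poly_Mapping.lookup m v}" and mV: "Poly_Mapping.keys m \<subseteq> V"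
    then obtain v where v: "v \<in> T" "Poly_Mapping.lookup m v > 0" by auto
    let ?n = "m - Poly_Mapping.single v 1"
    have m: "m = ?n + Poly_Mapping.single v 1" by (rule split_off_single[OF v(2)])
    then have "Poly_Mapping.keys m = Poly_Mapping.keys ?n \<union> Poly_Mapping.keys (Poly_Mapping.single v (1::nat))"
      by (metis keys_add_nat)
    then have "Poly_Mapping.single ?n c \<in> carrier (poly_ring V)" using mV by auto
    from ideal_poly_ring_closed(4)[OF Q T[OF v(1)] this] have "Poly_Mapping.single ?n c * var v \<in> Q" .
    then show "Poly_Mapping.single m c \<in> Q" unfolding var_def mult_single using m by simp
  qed
qed

section \<open>Facet ideals and their powers\<close>

definition set_monom :: "'v set \<Rightarrow> 'v \<Rightarrow>\<^sub>0 nat" where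
  "set_monom B = (\<Sum>v\<in>B. Poly_Mapping.single v 1)"

lemma prod_var:
  assumes "finite B"
  shows "(\<Prod>v\<in>B. (var v :: ('v, 'a::field) mpoly)) =
    Poly_Mapping.single (set_monom B) 1"
  using assms unfolding set_monom_def
  by (induction B rule: finite_induct) (auto simp: var_def mult_single)

lemma lookup_set_monom:
  assumes "finite B"
  shows "Poly_Mapping.lookup (set_monom B) u = (if u \<in> B then 1 else 0)"
  using assms by (simp add: set_monom_def lookup_sum lookup_single when_def)

lemma keys_set_monom:
  assumes "finite B"
  shows "Poly_Mapping.keys (set_monom B) = B"
  unfolding set_eq_iff in_keys_iff lookup_set_monom[OF assms] by simp

lemma split_off_set:
  fixes m :: "'v \<Rightarrow>\<^sub>0 nat"
  assumes "finite B" "\<And>v. v \<in> B \<Longrightarrow> Poly_Mapping.lookup m v > 0"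
  shows "m = (m - set_monom B) + set_monom B"
proof (rule poly_mapping_eqI)
  fix u
  show "Poly_Mapping.lookup m u = Poly_Mapping.lookup ((m - set_monom B) + set_monom B) u"
    using assms(2)[of u] unfolding lookup_add lookup_minus lookup_set_monom[OF assms(1)]
    by (cases "u \<in> B") auto
qed

text \<open>A monomial is divisible by the squarefree generator of \<open>B\<close> exactly when its
  exponents are positive on \<open>B\<close>, and divisibility by a generator decides membership in
  a monomial ideal.\<close>

lemma facet_ideal_eq:
  assumes fin: "finite (ground M)" and sub: "bases M \<subseteq> Pow (ground M)"
  shows "(facet_ideal M :: ('v, 'a::field) mpoly set) =
    mono_ideal (ground M) {m. \<exists>B\<in>bases M. \<forall>v\<in>B. Poly_Mapping.lookup m v > 0}" (is "_ = mono_ideal _ ?A")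
proof -
  let ?V = "ground M"
  let ?R = "poly_ring ?V :: ('v, 'a) mpoly ring"
  let ?G = "(\<lambda>B. \<Prod>v\<in>B. var v :: ('v, 'a) mpoly) ` bases M"
  interpret R: cring ?R by (rule cring_poly_ring)
  have finB: "finite B" "B \<subseteq> ?V" if "B \<in> bases M" for B
    using that sub fin by (auto intro: finite_subset)
  have "ideal (mono_ideal ?V ?A :: ('v, 'a) mpoly set) ?R"
    by (rule ideal_mono_ideal) (auto simp: lookup_add)
  moreover have G: "?G \<subseteq> mono_ideal ?V ?A"
  proof (rule image_subsetI)
    fix B assume B: "B \<in> bases M"
    have "set_monom B \<in> ?A" using B by (auto simp: lookup_set_monom[OF finB(1)[OF B]])
    then show "(\<Prod>v\<in>B. var v :: ('v, 'a) mpoly) \<in> mono_ideal ?V ?A"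
      unfolding prod_var[OF finB(1)[OF B]] single_in_mono_ideal[OF one_neq_zero]
        keys_set_monom[OF finB(1)[OF B]] using finB(2)[OF B] by blast
  qed
  ultimately have "facet_ideal M \<subseteq> (mono_ideal ?V ?A :: ('v, 'a) mpoly set)"
    unfolding facet_ideal_def by (rule R.genideal_minimal)
  moreover have "mono_ideal ?V ?A \<subseteq> (facet_ideal M :: ('v, 'a) mpoly set)"
  proof -
    have Gc: "?G \<subseteq> carrier ?R" using G by (auto simp: mono_ideal_def)
    have I: "ideal (facet_ideal M :: ('v, 'a) mpoly set) ?R"
      unfolding facet_ideal_def by (rule R.genideal_ideal[OF Gc])
    show ?thesis
    proof (rule mono_ideal_subsetI)
      show "p + q \<in> facet_ideal M" if "p \<in> facet_ideal M" "q \<in> facet_ideal M"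
        for p q :: "('v, 'a) mpoly" by (rule ideal_poly_ring_closed(2)[OF I that])
      show "(0 :: ('v, 'a) mpoly) \<in> facet_ideal M" by (rule ideal_poly_ring_closed(1)[OF I])
      fix m :: "'v \<Rightarrow>\<^sub>0 nat" and c :: 'a
      assume "m \<in> ?A" and mV: "Poly_Mapping.keys m \<subseteq> ?V"
      then obtain B where B: "B \<in> bases M" "\<And>v. v \<in> B \<Longrightarrow> Poly_Mapping.lookup m v > 0" by auto
      let ?n = "m - set_monom B"
      have m: "m = ?n + set_monom B"
        by (rule split_off_set) (use B finB in auto)
      have "Poly_Mapping.keys ?n \<subseteq> Poly_Mapping.keys m" by (metis m keys_add_nat Un_upper1)
      then have "Poly_Mapping.single ?n c \<in> carrier ?R" using mV by auto
      moreover have "(\<Prod>v\<in>B. var v :: ('v, 'a) mpoly) \<in> facet_ideal M"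
        unfolding facet_ideal_def by (rule subsetD[OF R.genideal_self[OF Gc]]) (use B in auto)
      ultimately have "Poly_Mapping.single ?n c * (\<Prod>v\<in>B. var v :: ('v, 'a) mpoly) \<in> facet_ideal M"
        using ideal_poly_ring_closed(4)[OF I] by blast
      then show "Poly_Mapping.single m c \<in> facet_ideal M"
        unfolding prod_var[OF finB(1)[OF B(1)]] mult_single using m by simp
    qed
  qed
  ultimately show ?thesis by blast
qed

text \<open>A product of \<open>q\<close> generators is recorded as a multiset because bases may
  repeat. The exponent of \<open>v\<close> in that product is the number of members containing
  \<open>v\<close>, so membership means that \<open>q\<close> bases fit below the exponents.\<close>

lemma ideal_power_facet_ideal:
  assumes fin: "finite (ground M)" and sub: "bases M \<subseteq> Pow (ground M)"
  shows "ideal_power (poly_ring (ground M)) (facet_ideal M :: ('v, 'a::field) mpoly set) q =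
    mono_ideal (ground M) {m. \<exists>Bs. size Bs = q \<and> set_mset Bs \<subseteq> bases M \<and>
      (\<forall>v. size (filter_mset (\<lambda>B. v \<in> B) Bs) \<le> Poly_Mapping.lookup m v)}"
  unfolding facet_ideal_eq[OF assms]
proof (rule ideal_power_mono_ideal[where F = "\<lambda>q. {m. \<exists>Bs. size Bs = q \<and> set_mset Bs \<subseteq> bases M \<and>
      (\<forall>v. size (filter_mset (\<lambda>B. v \<in> B) Bs) \<le> Poly_Mapping.lookup m v)}"], goal_cases)
  case (1 m)
  show ?case by auto
next
  case (2 n m)
  have finB: "finite B" if "B \<in> bases M" for B
    using that sub fin by (auto intro: finite_subset)
  show ?case
  proof (intro iffI, goal_cases)
    case 1
    then obtain Bs where Bs: "size Bs = Suc n" "set_mset Bs \<subseteq> bases M"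
        "\<And>v. size (filter_mset (\<lambda>B. v \<in> B) Bs) \<le> Poly_Mapping.lookup m v" by auto
    then obtain B Bs' where B: "Bs = add_mset B Bs'" by (metis size_eq_Suc_imp_eq_union)
    have fB: "finite B" using B Bs finB by auto
    let ?b = "set_monom B"
    \<comment> \<open>Subtraction of exponents is truncated; positivity on all of \<open>B\<close>
      makes it exact.\<close>
    have pos: "Poly_Mapping.lookup m v > 0" if "v \<in> B" for v
      using Bs(3)[of v] that B by auto
    have "m = (m - ?b) + ?b" by (rule split_off_set[OF fB pos])
    moreover have "\<forall>v. size (filter_mset (\<lambda>B. v \<in> B) Bs') \<le> Poly_Mapping.lookup (m - ?b) v"
    proof
      fix v show "size (filter_mset (\<lambda>B. v \<in> B) Bs') \<le> Poly_Mapping.lookup (m - ?b) v"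
        using Bs(3)[of v] unfolding B lookup_minus lookup_set_monom[OF fB] by (auto split: if_splits)
    qed
    then have "m - ?b \<in> {m. \<exists>Bs. size Bs = n \<and> set_mset Bs \<subseteq> bases M \<and>
      (\<forall>v. size (filter_mset (\<lambda>B. v \<in> B) Bs) \<le> Poly_Mapping.lookup m v)}"
      using B Bs by auto
    moreover have "?b \<in> {m. \<exists>B\<in>bases M. \<forall>v\<in>B. Poly_Mapping.lookup m v > 0}"
      unfolding mem_Collect_eq
    proof (rule bexI[of _ B], rule ballI)
      show "B \<in> bases M" using B Bs by auto
    qed (subst lookup_set_monom[OF fB], simp)
    ultimately show ?case by (intro bexI[of _ "m - ?b"] bexI[of _ ?b]) simp_all
  next
    case 2
    then obtain a b Bs B where ab: "m = a + b" "size Bs = n" "set_mset Bs \<subseteq> bases M"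
      "\<And>v. size (filter_mset (\<lambda>B. v \<in> B) Bs) \<le> Poly_Mapping.lookup a v"
      "B \<in> bases M" "\<And>v. v \<in> B \<Longrightarrow> Poly_Mapping.lookup b v > 0" by blast
    have "size (filter_mset (\<lambda>B. v \<in> B) (add_mset B Bs)) \<le> Poly_Mapping.lookup m v" for v
      using ab(4)[of v] ab(6)[of v] unfolding ab(1) lookup_add by (cases "v \<in> B") auto
    then show ?case using ab by (intro CollectI exI[of _ "add_mset B Bs"]) auto
  qed
qed

section \<open>Symbolic powers of facet ideals\<close>

definition vertex_cover :: "'v based_set \<Rightarrow> 'v set \<Rightarrow> bool" where
  "vertex_cover M T \<longleftrightarrow> T \<subseteq> ground M \<and> (\<forall>B\<in>bases M. B \<inter> T \<noteq> {})"

lemma prime_contains_var: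
  fixes Q :: "('v, 'a::field) mpoly set"
  assumes Q: "primeideal Q (poly_ring V)" and B: "finite B" "B \<subseteq> V" "(\<Prod>v\<in>B. var v) \<in> Q"
  shows "\<exists>v\<in>B. var v \<in> Q"
proof -
  interpret Q: primeideal Q "poly_ring V" by (rule Q)
  show ?thesis using B
  proof (induction B rule: finite_induct)
    case empty
    then show ?case using Q.one_imp_carrier Q.I_notcarr by auto
  next
    case (insert v B)
    have "(\<Prod>v\<in>B. var v :: ('v, 'a) mpoly) \<in> carrier (poly_ring V)"
      using insert.prems insert.hyps by (simp add: prod_var keys_set_monom)
    moreover have "(var v :: ('v, 'a) mpoly) \<in> carrier (poly_ring V)"
      using insert by (intro var_in_carrier) auto
    ultimately have "var v \<in> Q \<or> (\<Prod>v\<in>B. var v) \<in> Q"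
      using Q.I_prime[of "var v" "\<Prod>v\<in>B. var v"] insert by simp
    then show ?case using insert by auto
  qed
qed

text \<open>A prime containing a product of variables contains one of them, so the variables in
  \<open>Q\<close> meet every basis.\<close>

lemma vertex_cover_prime:
  fixes Q :: "('v, 'a::field) mpoly set"
  assumes fin: "finite (ground M)" and sub: "bases M \<subseteq> Pow (ground M)"
    and Q: "primeideal Q (poly_ring (ground M))" and IQ: "facet_ideal M \<subseteq> Q"
  shows "vertex_cover M {v. var v \<in> Q}"
  unfolding vertex_cover_def
proof (intro conjI ballI subsetI)
  interpret Q: primeideal Q "poly_ring (ground M)" by (rule Q)
  fix v assume "v \<in> {v. var v \<in> Q}"
  then have "(var v :: ('v, 'a) mpoly) \<in> carrier (poly_ring (ground M))"
    unfolding mem_Collect_eq by (rule Q.Icarr)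
  then show "v \<in> ground M" by (rule iffD1[OF var_in_carrier_iff])
next
  fix B assume B: "B \<in> bases M"
  then have fB: "finite B" "B \<subseteq> ground M" using fin sub by (auto intro: finite_subset)
  have "(\<Prod>v\<in>B. var v :: ('v, 'a) mpoly) \<in> facet_ideal M"
    unfolding facet_ideal_eq[OF fin sub] prod_var[OF fB(1)] single_in_mono_ideal[OF one_neq_zero]
      keys_set_monom[OF fB(1)]
    using B fB(2) by (auto simp: lookup_set_monom[OF fB(1)])
  then have "\<exists>v\<in>B. var v \<in> Q" using prime_contains_var[OF Q fB] IQ by blast
  then show "B \<inter> {v. var v \<in> Q} \<noteq> {}" by blast
qed

text \<open>The variables of a prime between the facet ideal and the prime of \<open>T\<close> form
  a cover inside \<open>T\<close>. Minimality makes this cover all of \<open>T\<close>, so the two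
  primes agree.\<close>

lemma minimal_cover_min_prime:
  fixes M :: "'v::linorder based_set"
  assumes fin: "finite (ground M)" and sub: "bases M \<subseteq> Pow (ground M)"
    and T: "vertex_cover M T" and min: "\<And>U. vertex_cover M U \<Longrightarrow> U \<subseteq> T \<Longrightarrow> U = T"
  shows "var_prime (ground M) T \<in> min_primes (poly_ring (ground M)) (facet_ideal M :: ('v, 'a::field) mpoly set)"
  unfolding min_primes_def
proof (intro CollectI conjI allI impI)
  let ?P = "var_prime (ground M) T :: ('v, 'a) mpoly set"
  show "primeideal ?P (poly_ring (ground M))" by (rule primeideal_var_prime)
  show "facet_ideal M \<subseteq> ?P"
    unfolding facet_ideal_eq[OF fin sub] var_prime_def
    by (rule mono_ideal_mono) (use T in \<open>fastforce simp: vertex_cover_def\<close>)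
  fix Q assume Q: "primeideal Q (poly_ring (ground M))" "facet_ideal M \<subseteq> Q" "Q \<subseteq> ?P"
  have "{v. var v \<in> Q} = T"
    by (rule min[OF vertex_cover_prime[OF fin sub Q(1,2)]]) (use Q(3) in \<open>auto dest!: subsetD simp: var_in_var_prime\<close>)
  then have "?P \<subseteq> Q"
    by (intro var_prime_subset[OF primeideal.axioms(1)[OF Q(1)]]) auto
  then show "Q = ?P" using Q(3) by blast
qed

text \<open>Minimal covers give minimal primes, and their conditions imply those at larger covers
  because exponents are nonnegative. Conversely, each minimal prime contains the prime generated by
  its variables, and this inclusion passes to powers.\<close>

theorem symbolic_power_facet_ideal:
  fixes M :: "'v::linorder based_set"
  assumes fin: "finite (ground M)" and sub: "bases M \<subseteq> Pow (ground M)"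
  shows "symbolic_power (poly_ring (ground M)) (facet_ideal M :: ('v, 'a::field) mpoly set) s =
    mono_ideal (ground M) {m. \<forall>T. vertex_cover M T \<longrightarrow> s \<le> msum m T}"
proof
  let ?R = "poly_ring (ground M) :: ('v, 'a) mpoly ring"
  have finT: "finite T" if "vertex_cover M T" for T
    using that fin finite_subset unfolding vertex_cover_def by blast
  show "symbolic_power ?R (facet_ideal M) s
      \<subseteq> mono_ideal (ground M) {m. \<forall>T. vertex_cover M T \<longrightarrow> s \<le> msum m T}"
  proof
    fix p :: "('v, 'a) mpoly" assume p: "p \<in> symbolic_power ?R (facet_ideal M) s"
    have "s \<le> msum m T" if m: "m \<in> Poly_Mapping.keys p" and T: "vertex_cover M T" for m T
    proof -
      have "finite {U. vertex_cover M U \<and> U \<subseteq> T}" by (rule finite_subset[of _ "Pow T"]) (use finT[OF T] in auto)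
      then obtain U where U: "vertex_cover M U" "U \<subseteq> T"
        "\<And>W. vertex_cover M W \<Longrightarrow> W \<subseteq> U \<Longrightarrow> W = U"
        using finite_has_minimal2[of "{U. vertex_cover M U \<and> U \<subseteq> T}" T] T by fastforce
      have "var_prime (ground M) U \<in> min_primes ?R (facet_ideal M)"
        by (rule minimal_cover_min_prime[OF fin sub U(1,3)])
      then have "p \<in> ideal_power ?R (var_prime (ground M) U) s"
        using p unfolding symbolic_power_def by blast
      then have "s \<le> msum m U"
        unfolding ideal_power_var_prime[OF finT[OF U(1)]] using m by (simp add: mono_ideal_def)
      also have "\<dots> \<le> msum m T" using finT[OF T] U(2) by (rule sum_mono2) simp
      finally show ?thesis .
    qed
    then show "p \<in> mono_ideal (ground M) {m. \<forall>T. vertex_cover M T \<longrightarrow> s \<le> msum m T}"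
      using p by (simp add: mono_ideal_def symbolic_power_def)
  qed
  show "mono_ideal (ground M) {m. \<forall>T. vertex_cover M T \<longrightarrow> s \<le> msum m T}
      \<subseteq> symbolic_power ?R (facet_ideal M) s"
    unfolding symbolic_power_def
  proof (intro Int_greatest INT_greatest)
    show "mono_ideal (ground M) {m. \<forall>T. vertex_cover M T \<longrightarrow> s \<le> msum m T} \<subseteq> carrier ?R"
      by (auto simp: mono_ideal_def)
    fix Q assume "Q \<in> min_primes ?R (facet_ideal M)"
    then have Q: "primeideal Q ?R" "facet_ideal M \<subseteq> Q" by (auto simp: min_primes_def)
    have T: "vertex_cover M {v. var v \<in> Q}" by (rule vertex_cover_prime[OF fin sub Q])
    have "mono_ideal (ground M) {m. \<forall>T. vertex_cover M T \<longrightarrow> s \<le> msum m T}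
        \<subseteq> ideal_power ?R (var_prime (ground M) {v. var v \<in> Q}) s"
      unfolding ideal_power_var_prime[OF finT[OF T]] by (rule mono_ideal_mono) (use T in blast)
    also have "\<dots> \<subseteq> ideal_power ?R Q s"
      by (rule ideal_power_mono[OF var_prime_subset[OF primeideal.axioms(1)[OF Q(1)]]]) simp
    finally show "mono_ideal (ground M) {m. \<forall>T. vertex_cover M T \<longrightarrow> s \<le> msum m T} \<subseteq> ideal_power ?R Q s" .
  qed
qed

section \<open>Packing bases into a vector\<close>

abbreviation load :: "'a set multiset \<Rightarrow> 'a \<Rightarrow> nat" where
  "load Bs v \<equiv> size (filter_mset (\<lambda>B. v \<in> B) Bs)"

text \<open>Double counting of the pairs formed by a member of \<open>Bs\<close> and a point of
  \<open>A\<close> lying in it.\<close>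

lemma sum_load:
  assumes "finite A"
  shows "(\<Sum>v\<in>A. load Bs v) = (\<Sum>B\<in>#Bs. card (B \<inter> A))"
proof (induction Bs)
  case (add B Bs)
  have "(\<Sum>v\<in>A. load (add_mset B Bs) v) = (\<Sum>v\<in>A. load Bs v + (if v \<in> B then 1 else 0))"
    by (rule sum.cong) auto
  also have "\<dots> = (\<Sum>v\<in>A. load Bs v) + card (A \<inter> B)"
    using assms by (simp add: sum.distrib sum.If_cases)
  finally show ?case using add by (simp add: Int_commute)
qed simp

text \<open>Peel off one \<open>k\<close>-set at a time. In the step from \<open>Suc q\<close> to
  \<open>q\<close> it must contain every point of value \<open>Suc q\<close> and only points of
  positive value; the total forces at most \<open>k\<close> points of the first kind and at least
  \<open>k\<close> of the second.\<close>

lemma exists_sets_with_load: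
  assumes E: "finite E"
  shows "(\<And>v. v \<in> E \<Longrightarrow> m v \<le> q) \<Longrightarrow> (\<Sum>v\<in>E. m v) = q * k \<Longrightarrow>
    \<exists>Bs. size Bs = q \<and> (\<forall>B\<in>#Bs. B \<subseteq> E \<and> card B = k) \<and> (\<forall>v\<in>E. load Bs v = m v)"
proof (induction q arbitrary: m)
  case 0
  then show ?case using E by (intro exI[of _ "{#}"]) auto
next
  case (Suc q)
  let ?F = "{v \<in> E. m v = Suc q}" and ?S = "{v \<in> E. m v > 0}"
  have "card ?F * Suc q = (\<Sum>v\<in>?F. m v)" by simp
  also have "\<dots> \<le> (\<Sum>v\<in>E. m v)" using E by (intro sum_mono2) auto
  finally have F: "card ?F \<le> k" unfolding Suc.prems(2) by (simp only: mult.commute[of "card ?F"] Suc_mult_le_cancel1)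
  have "Suc q * k = (\<Sum>v\<in>?S. m v)"
    unfolding Suc.prems(2)[symmetric] using E by (intro sum.mono_neutral_right) auto
  also have "\<dots> \<le> card ?S * Suc q"
    using sum_bounded_above[of ?S m "Suc q"] Suc.prems(1) by simp
  finally have S: "k \<le> card ?S" by (simp only: mult.commute[of "card ?S"] Suc_mult_le_cancel1)
  have "?F \<subseteq> ?S" "finite ?S" using E by auto
  then obtain B where B: "?F \<subseteq> B" "B \<subseteq> ?S" "card B = k"
    using exists_subset_between[OF F S] by blast
  define m' where "m' v = m v - (if v \<in> B then 1 else 0)" for v
  have mm': "m v = m' v + (if v \<in> B then 1 else 0)" if "v \<in> E" for v
    using B that unfolding m'_def by auto
  have "(\<Sum>v\<in>E. m v) = (\<Sum>v\<in>E. m' v) + card (E \<inter> B)"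
    using E by (simp add: mm' sum.distrib sum.If_cases)
  moreover have "E \<inter> B = B" using B by auto
  ultimately have "(\<Sum>v\<in>E. m' v) = q * k" using Suc.prems(2) B(3) by simp
  moreover have "m' v \<le> q" if "v \<in> E" for v
    using that Suc.prems(1)[OF that] B(1) unfolding m'_def by (cases "m v = Suc q") auto
  ultimately obtain Bs where Bs: "size Bs = q" "\<forall>B\<in>#Bs. B \<subseteq> E \<and> card B = k" "\<forall>v\<in>E. load Bs v = m' v"
    using Suc.IH[of m'] by blast
  have "\<forall>v\<in>E. load (add_mset B Bs) v = m v" using Bs(3) mm' by auto
  then show ?case using Bs B by (intro exI[of _ "add_mset B Bs"]) auto
qed

lemma card_exchange:
  assumes "finite B" "u \<notin> B" "v \<in> B"
  shows "card (insert u (B - {v})) = card B" "card (B \<inter> insert u (B - {v})) = card B - 1"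
proof -
  have "B \<inter> insert u (B - {v}) = B - {v}" using assms by auto
  then show "card (B \<inter> insert u (B - {v})) = card B - 1" using assms by simp
  show "card (insert u (B - {v})) = card B" using assms by (simp add: card.remove[of B v] del: card_Diff_insert)
qed

text \<open>The load hypothesis says that the members of \<open>Bs\<close> meet each
  \<open>D\<close> in at most \<open>k - 1\<close> points on average. If \<open>D\<close> itself
  occurs, some member \<open>B\<close> meets it in at most \<open>k - 2\<close> points, and swapping
  a point of \<open>D\<close> with a point of \<open>B\<close> removes \<open>D\<close> without
  creating a forbidden set. Loads stay the same and the number of forbidden members drops.\<close>

lemma avoid_family:
  assumes E: "finite E"
    and Ds: "\<And>D. D \<in> Ds \<Longrightarrow> D \<subseteq> E \<and> card D = k"
    and sep: "\<And>C D. C \<in> Ds \<Longrightarrow> D \<in> Ds \<Longrightarrow> C \<noteq> D \<Longrightarrow> card (C \<inter> D) + 2 \<le> k"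
  shows "(\<forall>B\<in>#Bs. B \<subseteq> E \<and> card B = k) \<Longrightarrow>
    (\<And>D. D \<in> Ds \<Longrightarrow> (\<Sum>v\<in>D. load Bs v) + size Bs \<le> size Bs * k) \<Longrightarrow>
    \<exists>Bs'. size Bs' = size Bs \<and> (\<forall>B\<in>#Bs'. B \<subseteq> E \<and> card B = k \<and> B \<notin> Ds) \<and> load Bs' = load Bs"
proof (induction "size (filter_mset (\<lambda>B. B \<in> Ds) Bs)" arbitrary: Bs rule: less_induct)
  case less
  show ?case
  proof (cases "\<forall>B\<in>#Bs. B \<notin> Ds")
    case True
    then show ?thesis using less.prems(1) by blast
  next
    case False
    then obtain D where D: "D \<in># Bs" "D \<in> Ds" by blast
    have Dk: "D \<subseteq> E" "card D = k" "finite D" using Ds[OF D(2)] E finite_subset by auto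
    have "\<exists>B\<in>#Bs. card (B \<inter> D) + 2 \<le> k"
    proof (rule ccontr)
      \<comment> \<open>Otherwise \<open>D\<close> contributes \<open>k\<close> and every other
        member at least \<open>k - 1\<close>, one more in total than the load bound allows.\<close>
      assume "\<not> ?thesis"
      then have ge: "k - 1 \<le> card (B \<inter> D)" if "B \<in># Bs" for B using that by force
      obtain R where R: "Bs = add_mset D R" using D(1) by (metis insert_DiffM)
      have "(\<Sum>B\<in>#R. k - 1) \<le> (\<Sum>B\<in>#R. card (B \<inter> D))"
        by (rule sum_mset_mono) (use ge R in auto)
      then have "size R * (k - 1) + k \<le> (\<Sum>v\<in>D. load Bs v)"
        unfolding sum_load[OF Dk(3)] R using Dk by simp
      with less.prems(2)[OF D(2)] have "size R * (k - 1) + k + Suc (size R) \<le> Suc (size R) * k"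
        by (simp add: R)
      moreover have "k > 0" using less.prems(2)[OF D(2)] R by (cases k) auto
      then obtain j where "k = Suc j" by (cases k) auto
      ultimately show False by simp
    qed
    then obtain B where B: "B \<in># Bs" "card (B \<inter> D) + 2 \<le> k" by blast
    have Bk: "B \<subseteq> E" "card B = k" "finite B"
      using less.prems(1) B finite_subset[OF _ E, of B] by auto
    have "B \<noteq> D" using B Dk by auto
    then obtain R where R: "Bs = add_mset D (add_mset B R)"
      using B(1) D(1) by (metis insert_DiffM insert_noteq_member)
    have "card (D - B) \<ge> 2" "card (B - D) \<ge> 2"
      using B(2) Bk Dk by (simp_all add: card_Diff_subset_Int Int_commute)
    then have "D - B \<noteq> {}" and "\<exists>V. V \<subseteq> B - D \<and> card V = 2"
      using obtain_subset_with_card_n by (force, metis)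
    then obtain u v1 v2 where uv: "u \<in> D" "u \<notin> B" "v1 \<in> B" "v1 \<notin> D" "v2 \<in> B" "v2 \<notin> D" "v1 \<noteq> v2"
      by (auto simp: card_2_iff)
    let ?ex = "\<lambda>v. insert u (B - {v})"
    \<comment> \<open>Two candidates for the point leaving \<open>B\<close> are kept: the resulting
      sets share \<open>k - 1\<close> points, so they cannot both be forbidden.\<close>
    have "\<not> (?ex v1 \<in> Ds \<and> ?ex v2 \<in> Ds)"
    proof
      assume ex: "?ex v1 \<in> Ds \<and> ?ex v2 \<in> Ds"
      have "?ex v1 \<noteq> ?ex v2" using uv by auto
      then have "card (?ex v1 \<inter> ?ex v2) + 2 \<le> k" using sep ex by blast
      moreover have "?ex v1 \<inter> ?ex v2 = insert u (B - {v1, v2})" using uv by auto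
      moreover have "card (insert u (B - {v1, v2})) = Suc (k - 2)"
        using uv Bk by (simp add: card_Diff_subset)
      ultimately show False by simp
    qed
    then obtain v where v: "v \<in> B" "v \<notin> D" "?ex v \<notin> Ds" using uv by blast
    let ?D = "insert v (D - {u})"
    have D': "card ?D = k" "card (D \<inter> ?D) = k - 1"
      using card_exchange[OF Dk(3) v(2) uv(1)] Dk by simp_all
    have "k > 0" using Dk uv by (auto simp: card_gt_0_iff)
    \<comment> \<open>The modified \<open>D\<close> still shares \<open>k - 1\<close> points with
      \<open>D\<close>, so the separation of \<open>Ds\<close> excludes it from the family.\<close>
    have "?D \<noteq> D" using v by auto
    then have D'D: "?D \<notin> Ds" using sep[OF D(2), of ?D] D'(2) \<open>k > 0\<close> by auto
    let ?Bs = "add_mset ?D (add_mset (?ex v) R)"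
    have ld: "load ?Bs w = load Bs w" for w
      using uv v by (auto simp: R)
    have k': "\<forall>B\<in>#?Bs. B \<subseteq> E \<and> card B = k"
      using less.prems(1) D' card_exchange(1)[OF Bk(3) uv(2) v(1)] Bk Dk uv v R by auto
    have "size (filter_mset (\<lambda>B. B \<in> Ds) ?Bs) < size (filter_mset (\<lambda>B. B \<in> Ds) Bs)"
      using D D'D v(3) by (simp add: R)
    moreover have "size ?Bs = size Bs" by (simp add: R)
    ultimately show ?thesis
      using less.hyps[of ?Bs, OF _ k'] less.prems(2) unfolding ld by (simp add: fun_eq_iff ld)
  qed
qed

text \<open>Units are removed one at a time. While the total exceeds \<open>q * k\<close>, at most
  one \<open>D\<close> has weight exactly \<open>q\<close> outside it, and a unit taken from inside
  that \<open>D\<close> leaves the tight constraint untouched, while the slack ones can afford to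
  lose one.\<close>

lemma shrink_vector:
  fixes m :: "'a \<Rightarrow> nat"
  assumes E: "finite E" and k: "0 < k" "k \<le> card E"
    and Ds: "\<And>D. D \<in> Ds \<Longrightarrow> D \<subseteq> E \<and> card D = k"
    and sep: "\<And>C D. C \<in> Ds \<Longrightarrow> D \<in> Ds \<Longrightarrow> C \<noteq> D \<Longrightarrow> card (C \<inter> D) + 2 \<le> k"
  shows "(\<And>v. v \<in> E \<Longrightarrow> m v \<le> q) \<Longrightarrow> (\<And>D. D \<in> Ds \<Longrightarrow> q \<le> (\<Sum>v\<in>E-D. m v)) \<Longrightarrow>
    q * k \<le> (\<Sum>v\<in>E. m v) \<Longrightarrow>
    \<exists>m'. (\<forall>v\<in>E. m' v \<le> m v) \<and> (\<forall>D\<in>Ds. q \<le> (\<Sum>v\<in>E-D. m' v)) \<and> (\<Sum>v\<in>E. m' v) = q * k"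
proof (induction "\<Sum>v\<in>E. m v" arbitrary: m rule: less_induct)
  case less
  show ?case
  proof (cases "(\<Sum>v\<in>E. m v) = q * k")
    case True
    then show ?thesis using less.prems by blast
  next
    case False
    then have big: "q * k < (\<Sum>v\<in>E. m v)" using less.prems(3) by simp
    \<comment> \<open>The complements of two tight sets together carry at most \<open>2 * q\<close>;
      what remains is \<open>C \<inter> D\<close>, with at most \<open>k - 2\<close> points of value
      at most \<open>q\<close>, so the total would not exceed \<open>q * k\<close>.\<close>
    have unique: "C = D" if C: "C \<in> Ds" "(\<Sum>v\<in>E-C. m v) = q" and D: "D \<in> Ds" "(\<Sum>v\<in>E-D. m v) = q" for C D
    proof (rule ccontr)
      assume "C \<noteq> D"
      then have "card (C \<inter> D) + 2 \<le> k" using sep C D by blast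
      have "(\<Sum>v\<in>E. m v) \<le> (\<Sum>v\<in>(E-C) \<union> (E-D). m v) + (\<Sum>v\<in>C \<inter> D. m v)"
      proof -
        have "E = ((E-C) \<union> (E-D)) \<union> (C \<inter> D)" using Ds C D by blast
        then show ?thesis using E Ds[OF C(1)] by (metis finite_Diff finite_Int finite_Un finite_subset sum_Un_nat diff_le_self)
      qed
      also have "(\<Sum>v\<in>(E-C) \<union> (E-D). m v) \<le> q + q"
        using sum_Un_nat[of "E-C" "E-D" m] E C D by simp
      also have "(\<Sum>v\<in>C \<inter> D. m v) \<le> card (C \<inter> D) * q"
        using sum_bounded_above[of "C \<inter> D" m q] less.prems(1) Ds C by auto
      also have "q + q + card (C \<inter> D) * q = (card (C \<inter> D) + 2) * q" by (simp add: algebra_simps)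
      also have "\<dots> \<le> k * q" using \<open>card (C \<inter> D) + 2 \<le> k\<close> by (rule mult_le_mono1)
      finally show False using big by (simp add: mult.commute)
    qed
    have "\<exists>u\<in>E. m u > 0 \<and> (\<forall>D\<in>Ds. (\<Sum>v\<in>E-D. m v) = q \<longrightarrow> u \<in> D)"
    proof (rule ccontr)
      assume "\<not> ?thesis"
      then have neg: "\<exists>D\<in>Ds. (\<Sum>v\<in>E-D. m v) = q \<and> u \<notin> D" if "u \<in> E" "m u > 0" for u using that by blast
      show False
      proof (cases "\<exists>D\<in>Ds. (\<Sum>v\<in>E-D. m v) = q")
        case True
        then obtain D where D: "D \<in> Ds" "(\<Sum>v\<in>E-D. m v) = q" by blast
        \<comment> \<open>Without an admissible unit, the unique tight \<open>D\<close> would carry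
          no weight, and the total would be only \<open>q\<close>.\<close>
        have "m u = 0" if "u \<in> D" for u
          using neg[of u] unique[OF D] Ds[OF D(1)] that by blast
        then have "(\<Sum>v\<in>E. m v) = (\<Sum>v\<in>E-D. m v)"
          using E by (intro sum.mono_neutral_right) auto
        then show False using D(2) big k by (cases k) auto
      next
        case False
        then have "m u = 0" if "u \<in> E" for u using neg that by blast
        then show False using big by simp
      qed
    qed
    then obtain u where u: "u \<in> E" "m u > 0" "\<And>D. D \<in> Ds \<Longrightarrow> (\<Sum>v\<in>E-D. m v) = q \<Longrightarrow> u \<in> D" by blast
    define m' where "m' = m(u := m u - 1)"
    have m'_le: "m' v \<le> m v" for v by (simp add: m'_def)
    have sum_in: "(\<Sum>v\<in>A. m v) = Suc (\<Sum>v\<in>A. m' v)" if "u \<in> A" "finite A" for A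
    proof -
      have "(\<Sum>v\<in>A - {u}. m' v) = (\<Sum>v\<in>A - {u}. m v)" by (rule sum.cong) (auto simp: m'_def)
      then show ?thesis using that u(2) by (simp add: sum.remove[of A u] m'_def)
    qed
    have sum_out: "(\<Sum>v\<in>A. m' v) = (\<Sum>v\<in>A. m v)" if "u \<notin> A" for A
      by (rule sum.cong) (use that in \<open>auto simp: m'_def\<close>)
    have "q \<le> (\<Sum>v\<in>E-D. m' v)" if "D \<in> Ds" for D
    proof (cases "u \<in> D")
      case True
      then show ?thesis using sum_out[of "E-D"] less.prems(2)[OF that] by simp
    next
      case False
      then have "(\<Sum>v\<in>E-D. m v) \<noteq> q" using u(3) that by blast
      then show ?thesis using sum_in[of "E-D"] less.prems(2)[OF that] False u(1) E by simp
    qed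
    moreover have "m' v \<le> q" if "v \<in> E" for v using m'_le less.prems(1)[OF that] le_trans by blast
    moreover have "(\<Sum>v\<in>E. m' v) < (\<Sum>v\<in>E. m v)" "q * k \<le> (\<Sum>v\<in>E. m' v)"
      using sum_in[OF u(1) E] big by simp_all
    ultimately obtain m'' where "\<forall>v\<in>E. m'' v \<le> m' v" "\<forall>D\<in>Ds. q \<le> (\<Sum>v\<in>E-D. m'' v)"
      "(\<Sum>v\<in>E. m'' v) = q * k"
      using less.hyps[of m'] by blast
    then show ?thesis using m'_le le_trans by (intro exI[of _ m'']) blast
  qed
qed

text \<open>A point lies in at most \<open>q\<close> of the \<open>q\<close> members, which is why
  \<open>tot\<close> truncates the values at \<open>q\<close>. After shrinking to total
  \<open>q * k\<close>, weight at least \<open>q\<close> outside \<open>D\<close> leaves at most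
  \<open>q * (k - 1)\<close> on \<open>D\<close>, which is the load bound that the exchanges
  require.\<close>

proposition pack_sparse_paving_bases:
  fixes m :: "'a \<Rightarrow> nat"
  assumes E: "finite E" and k: "0 < k" "k \<le> card E"
    and Ds: "\<And>D. D \<in> Ds \<Longrightarrow> D \<subseteq> E \<and> card D = k"
    and sep: "\<And>C D. C \<in> Ds \<Longrightarrow> D \<in> Ds \<Longrightarrow> C \<noteq> D \<Longrightarrow> card (C \<inter> D) + 2 \<le> k"
    and low: "\<And>D. D \<in> Ds \<Longrightarrow> q \<le> (\<Sum>v\<in>E-D. m v)"
    and tot: "q * k \<le> (\<Sum>v\<in>E. min (m v) q)"
  shows "\<exists>Bs. size Bs = q \<and> (\<forall>B\<in>#Bs. B \<subseteq> E \<and> card B = k \<and> B \<notin> Ds) \<and> (\<forall>v. load Bs v \<le> m v)"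
proof -
  \<comment> \<open>Truncation keeps the lower bound: one value reaching \<open>q\<close> suffices
    by itself, and otherwise nothing is truncated.\<close>
  have "q \<le> (\<Sum>v\<in>E-D. min (m v) q)" if D: "D \<in> Ds" for D
  proof (cases "\<exists>u\<in>E-D. q \<le> m u")
    case True
    then obtain u where u: "u \<in> E - D" "q \<le> m u" by blast
    have "min (m u) q \<le> (\<Sum>v\<in>E-D. min (m v) q)"
      by (rule member_le_sum) (use u E in auto)
    then show ?thesis using u by simp
  next
    case False
    then have "min (m v) q = m v" if "v \<in> E - D" for v using that by (meson min.absorb1 nat_le_linear)
    then have "(\<Sum>v\<in>E-D. min (m v) q) = (\<Sum>v\<in>E-D. m v)" by (intro sum.cong) auto
    then show ?thesis using low[OF D] by simp
  qed
  then obtain m' where m': "\<forall>v\<in>E. m' v \<le> min (m v) q" "\<forall>D\<in>Ds. q \<le> (\<Sum>v\<in>E-D. m' v)"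
      "(\<Sum>v\<in>E. m' v) = q * k"
    using shrink_vector[OF E k Ds sep, of Ds "\<lambda>v. min (m v) q" q] tot by auto
  obtain Bs where Bs: "size Bs = q" "\<forall>B\<in>#Bs. B \<subseteq> E \<and> card B = k" "\<forall>v\<in>E. load Bs v = m' v"
    using exists_sets_with_load[OF E, of m' q k] m' by auto
  have "(\<Sum>v\<in>D. load Bs v) + size Bs \<le> size Bs * k" if D: "D \<in> Ds" for D
  proof -
    have "D \<subseteq> E" using Ds[OF D] by blast
    then have "(\<Sum>v\<in>D. load Bs v) = (\<Sum>v\<in>D. m' v)" using Bs(3) by (intro sum.cong) auto
    moreover have "(\<Sum>v\<in>E. m' v) = (\<Sum>v\<in>E-D. m' v) + (\<Sum>v\<in>D. m' v)"
      using E \<open>D \<subseteq> E\<close> by (rule sum.subset_diff[rotated])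
    ultimately show ?thesis using m'(2,3) D Bs(1) by fastforce
  qed
  then obtain Bs' where Bs': "size Bs' = size Bs" "\<forall>B\<in>#Bs'. B \<subseteq> E \<and> card B = k \<and> B \<notin> Ds"
      "load Bs' = load Bs"
    using avoid_family[OF E Ds sep, of Ds Bs] Bs(2) by blast
  have "load Bs' v \<le> m v" for v
  proof (cases "v \<in> E")
    case True
    then show ?thesis using Bs(3) m'(1) fun_cong[OF Bs'(3), of v] by force
  next
    case False
    then have "filter_mset (\<lambda>B. v \<in> B) Bs' = {#}" using Bs'(2) by (auto simp: filter_mset_eq_conv)
    then show ?thesis by (metis size_empty le0)
  qed
  then show ?thesis using Bs' Bs(1) by blast
qed

section \<open>Bases and vertex covers of $M_{k,2k-1}$\<close>

text \<open>The circuit-hyperplanes of the dual matroid, i.e. the only \<open>k\<close>-subsets that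
  fail to be bases of \<open>M_matroid k\<close>.\<close>

definition D_sets :: "nat \<Rightarrow> elt set set" where
  "D_sets k = (\<lambda>i. E_set k - C_set k i) ` {0..k-1}"

lemma C_setE:
  assumes "k \<ge> 5" "i \<le> k - 1"
  shows "C_set k i \<subseteq> E_set k" "card (C_set k i) = k - 1" "finite (C_set k i)"
  using C_set_card[OF assms] card_E_set[OF assms(1)] finite_subset by auto

lemma ground_M_matroid: "ground (M_matroid k) = E_set k"
  by (simp add: M_matroid_def N_matroid_def dual_def)

lemma bases_M_matroid:
  assumes k: "k \<ge> 5"
  shows "bases (M_matroid k) = {B. B \<subseteq> E_set k \<and> card B = k \<and> B \<notin> D_sets k}"
proof (intro equalityI subsetI)
  note E = card_E_set[OF k]
  fix B assume "B \<in> bases (M_matroid k)"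
  then obtain A where A: "A \<subseteq> E_set k" "card A = k - 1" "A \<notin> C_set k ` {0..k-1}" "B = E_set k - A"
    by (auto simp: M_matroid_def N_matroid_def dual_def)
  have "B \<notin> D_sets k"
  proof
    assume "B \<in> D_sets k"
    then obtain i where i: "i \<le> k - 1" "E_set k - A = E_set k - C_set k i" using A by (auto simp: D_sets_def)
    then have "A = C_set k i" using A(1) C_setE(1)[OF k i(1)] by blast
    then show False using A(3) i by simp
  qed
  then show "B \<in> {B. B \<subseteq> E_set k \<and> card B = k \<and> B \<notin> D_sets k}"
    using A E k by (auto simp: card_Diff_subset finite_subset)
next
  note E = card_E_set[OF k]
  fix B assume "B \<in> {B. B \<subseteq> E_set k \<and> card B = k \<and> B \<notin> D_sets k}"
  then have B: "B \<subseteq> E_set k" "card B = k" "B \<notin> D_sets k" by auto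
  then have BE: "B = E_set k - (E_set k - B)" by auto
  have "card (E_set k - B) = k - 1"
    using B E k by (auto simp: card_Diff_subset finite_subset)
  moreover have "E_set k - B \<notin> C_set k ` {0..k-1}"
  proof
    assume "E_set k - B \<in> C_set k ` {0..k-1}"
    then have "E_set k - (E_set k - B) \<in> D_sets k" unfolding D_sets_def by blast
    then show False using B(3) BE by simp
  qed
  ultimately show "B \<in> bases (M_matroid k)"
    using BE by (auto simp: M_matroid_def N_matroid_def dual_def)
qed

lemma D_sets_card:
  assumes k: "k \<ge> 5" and D: "D \<in> D_sets k"
  shows "D \<subseteq> E_set k \<and> card D = k"
proof -
  obtain i where i: "i \<le> k - 1" "D = E_set k - C_set k i" using D by (auto simp: D_sets_def)
  then show ?thesis using C_setE[OF k i(1)] card_E_set[OF k] k by (simp add: card_Diff_subset)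
qed

text \<open>The ground set has \<open>2 * k - 1\<close> points, so the complements of two of its
  \<open>(k - 1)\<close>-subsets share exactly one point more than the subsets themselves.\<close>

lemma D_sets_Int:
  assumes k: "k \<ge> 5" and D: "D \<in> D_sets k" "D' \<in> D_sets k" "D \<noteq> D'"
  shows "card (D \<inter> D') + 2 \<le> k"
proof -
  obtain i where i: "i \<le> k - 1" "D = E_set k - C_set k i" using D(1) by (auto simp: D_sets_def)
  obtain j where j: "j \<le> k - 1" "D' = E_set k - C_set k j" using D(2) by (auto simp: D_sets_def)
  have "i \<noteq> j" using i j D(3) by auto
  then have int: "card (C_set k i \<inter> C_set k j) + 2 \<le> k - 1"
    using C_set_Int[OF k, of i j] C_set_Int[OF k, of j i] i(1) j(1)
    by (cases "i < j") (simp_all add: Int_commute)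
  have "D \<inter> D' = E_set k - (C_set k i \<union> C_set k j)" using i j by blast
  moreover have "card (C_set k i \<union> C_set k j) + card (C_set k i \<inter> C_set k j) = 2 * (k - 1)"
    using card_Un_Int[of "C_set k i" "C_set k j"] C_setE[OF k i(1)] C_setE[OF k j(1)] by simp
  moreover have "card (E_set k - (C_set k i \<union> C_set k j)) = 2 * k - 1 - card (C_set k i \<union> C_set k j)"
    using C_setE[OF k i(1)] C_setE[OF k j(1)] card_E_set[OF k] by (simp add: card_Diff_subset)
  ultimately have "card (D \<inter> D') = 2 * k - 1 - card (C_set k i \<union> C_set k j)"
    "card (C_set k i \<union> C_set k j) + card (C_set k i \<inter> C_set k j) = 2 * (k - 1)" by simp_all
  then show ?thesis using int k by linarith
qed

text \<open>The only \<open>k\<close>-subset disjoint from a circuit-hyperplane is its complement,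
  which is not a basis.\<close>

lemma vertex_cover_C_set:
  assumes k: "k \<ge> 5" and i: "i \<le> k - 1"
  shows "vertex_cover (M_matroid k) (C_set k i)"
  unfolding vertex_cover_def ground_M_matroid
proof (intro conjI ballI notI)
  show "C_set k i \<subseteq> E_set k" by (rule C_setE(1)[OF k i])
  fix B assume "B \<in> bases (M_matroid k)" and int: "B \<inter> C_set k i = {}"
  then have B: "B \<subseteq> E_set k" "card B = k" "B \<notin> D_sets k" by (auto simp: bases_M_matroid[OF k])
  have D: "E_set k - C_set k i \<in> D_sets k" using i by (auto simp: D_sets_def)
  have "B = E_set k - C_set k i"
    by (rule card_subset_eq) (use B int D_sets_card[OF k D] card_E_set[OF k] in auto)
  then show False using B D by simp
qed

text \<open>Two disjoint \<open>k\<close>-sets do not fit into \<open>2 * k - 1\<close>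
  points.\<close>

lemma vertex_cover_large:
  assumes k: "k \<ge> 5" and U: "U \<subseteq> E_set k" "card U = k"
  shows "vertex_cover (M_matroid k) U"
  unfolding vertex_cover_def ground_M_matroid
proof (intro conjI ballI notI)
  show "U \<subseteq> E_set k" by (rule U)
  fix B assume "B \<in> bases (M_matroid k)" and int: "B \<inter> U = {}"
  then have B: "B \<subseteq> E_set k" "card B = k" by (auto simp: bases_M_matroid[OF k])
  have "card (B \<union> U) = k + k"
    using card_Un_disjoint[of B U] B U int card_E_set[OF k] finite_subset by metis
  moreover have "card (B \<union> U) \<le> 2 * k - 1"
    using card_mono[of "E_set k" "B \<union> U"] B U card_E_set[OF k] by simp
  ultimately show False using k by simp
qed

text \<open>If \<open>T\<close> has fewer than \<open>k\<close> points, the complement of each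
  \<open>(k - 1)\<close>-set containing \<open>T\<close> misses \<open>T\<close> and so is not a
  basis; that \<open>(k - 1)\<close>-set is therefore a circuit-hyperplane. Were \<open>T\<close>
  smaller than \<open>k - 1\<close>, exchanging one point would give two circuit-hyperplanes with
  \<open>k - 2\<close> common points.\<close>

lemma vertex_cover_cases:
  assumes k: "k \<ge> 5" and T: "vertex_cover (M_matroid k) T"
  obtains i where "i \<le> k - 1" "C_set k i \<subseteq> T" | U where "U \<subseteq> T" "U \<subseteq> E_set k" "card U = k"
proof -
  note E = card_E_set[OF k]
  have TE: "T \<subseteq> E_set k" "finite T" using T E finite_subset unfolding vertex_cover_def ground_M_matroid by auto
  show thesis
  proof (cases "k \<le> card T")
    case True
    then obtain U where "U \<subseteq> T" "card U = k" using obtain_subset_with_card_n by metis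
    then show thesis using that(2) TE by blast
  next
    case False
    have key: "W \<in> C_set k ` {0..k-1}" if W: "T \<subseteq> W" "W \<subseteq> E_set k" "card W = k - 1" for W
    proof -
      have "card (E_set k - W) = k" using W E k finite_subset[of W "E_set k"] by (auto simp: card_Diff_subset)
      moreover have "E_set k - W \<notin> bases (M_matroid k)"
        using T W unfolding vertex_cover_def by blast
      ultimately have "E_set k - W \<in> D_sets k" unfolding bases_M_matroid[OF k] by blast
      then obtain i where i: "i \<le> k - 1" "E_set k - W = E_set k - C_set k i" by (auto simp: D_sets_def)
      then have "W = C_set k i" using W(2) C_setE(1)[OF k i(1)] by blast
      then show ?thesis using i by simp
    qed
    have "card T \<le> k - 1" "k - 1 \<le> card (E_set k)" "finite (E_set k)" using E k False by auto
    then obtain W where W: "T \<subseteq> W" "W \<subseteq> E_set k" "card W = k - 1"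
      using exists_subset_between[OF _ _ TE(1), of "k - 1"] by blast
    have WT: "W = T"
    proof (rule ccontr)
      assume "W \<noteq> T"
      then obtain v where v: "v \<in> W" "v \<notin> T" using W by blast
      have fW: "finite W" using W(2) E finite_subset by blast
      have "card W < card (E_set k)" using W E k by simp
      then obtain u where u: "u \<in> E_set k" "u \<notin> W" using W by (metis card_mono fW leD subsetI)
      let ?W = "insert u (W - {v})"
      have c: "card ?W = k - 1" "card (W \<inter> ?W) = k - 1 - 1" "?W \<noteq> W"
        using card_exchange[OF fW u(2) v(1)] W u by auto
      have "?W \<in> C_set k ` {0..k-1}" by (rule key) (use c W v u in auto)
      then obtain j where j: "j \<le> k - 1" "?W = C_set k j" by auto
      obtain i where i: "i \<le> k - 1" "W = C_set k i" using key[OF W] by auto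
      have "i \<noteq> j" using i j c(3) by auto
      then have "card (C_set k i \<inter> C_set k j) + 2 \<le> k - 1"
        using C_set_Int[OF k, of i j] C_set_Int[OF k, of j i] i(1) j(1)
        by (cases "i < j") (simp_all add: Int_commute)
      then show False using c(2) i j k by simp
    qed
    then show thesis using key[OF W] that(1) by auto
  qed
qed

section \<open>Linear inequalities on the symbolic polyhedron\<close>

text \<open>Induction on the surplus of points: apply the bound to \<open>T\<close> with one point
  removed and add over all points of \<open>T\<close>; each value is then counted
  \<open>card T - 1\<close> times.\<close>

lemma sum_subset_average:
  fixes f :: "'a \<Rightarrow> real" and s :: real
  assumes k: "k > 0"
  shows "finite T \<Longrightarrow> k \<le> card T \<Longrightarrow> (\<And>U. U \<subseteq> T \<Longrightarrow> card U = k \<Longrightarrow> s \<le> sum f U) \<Longrightarrow>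
    s * card T \<le> k * sum f T"
proof (induction "card T - k" arbitrary: T)
  case 0
  then have "s \<le> sum f T" "card T = k" by auto
  then show ?case by (simp add: mult.commute[of s] mult_left_mono)
next
  case (Suc n)
  let ?t = "card T"
  have t: "?t \<ge> k + 1" using Suc.hyps(2) by linarith
  have "s * (?t - 1) \<le> k * (sum f T - f e)" if e: "e \<in> T" for e
  proof -
    have c: "card (T - {e}) = ?t - 1" using e Suc.prems(1) by simp
    have "s * card (T - {e}) \<le> k * sum f (T - {e})"
      by (rule Suc.hyps(1)) (use Suc c t in auto)
    then show ?thesis using c t k e Suc.prems(1) by (simp add: sum_diff1 of_nat_diff)
  qed
  then have "(\<Sum>e\<in>T. s * (?t - 1)) \<le> (\<Sum>e\<in>T. k * (sum f T - f e))" by (rule sum_mono)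
  also have "\<dots> = k * (?t * sum f T - sum f T)"
    by (simp add: sum_distrib_left[symmetric] sum_subtractf)
  finally have "(real ?t - 1) * (s * ?t) \<le> (real ?t - 1) * (k * sum f T)"
    using t by (simp add: algebra_simps of_nat_diff del: One_nat_def)
  moreover have "real ?t - 1 > 0" using t k by simp
  ultimately show ?case by (simp only: mult_le_cancel_left_pos)
qed

text \<open>The last two circuit-hyperplanes share only \<open>Pc\<close> and contain neither
  \<open>Pa\<close> nor \<open>Pb\<close>, while \<open>Pc\<close> is absent from the first
  one.\<close>

lemma missed_by_C_set:
  assumes k: "k \<ge> 5"
  shows "\<exists>i\<le>k-1. e \<notin> C_set k i"
proof (cases e)
  case (Num j)
  have "Num j \<notin> C_set k (k-2) \<or> Num j \<notin> C_set k (k-1)"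
    using k by (auto simp: C_set_def) presburger+
  then show ?thesis using Num by (metis diff_le_mono2 one_le_numeral order_refl)
next
  case Pa
  then have "e \<notin> C_set k (k-2)" using k by (auto simp: C_set_def)
  then show ?thesis by (intro exI[of _ "k-2"]) auto
next
  case Pb
  then have "e \<notin> C_set k (k-2)" using k by (auto simp: C_set_def)
  then show ?thesis by (intro exI[of _ "k-2"]) auto
next
  case Pc
  then have "e \<notin> C_set k 0" using k by (auto simp: C_set_def)
  then show ?thesis by blast
qed

text \<open>The circuit-hyperplane \<open>C\<close> avoiding the omitted point lies in
  \<open>T\<close>. With \<open>u\<close> of least value on \<open>C\<close>, the points of
  \<open>T - C\<close> and \<open>u\<close> form a \<open>k\<close>-set, so \<open>sum f T\<close>
  is at least \<open>s - f u\<close> plus \<open>sum f C\<close>, and \<open>sum f C\<close> is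
  bounded below both by \<open>s\<close> and by \<open>(k - 1) * f u\<close>.\<close>

lemma sum_without_point:
  fixes f :: "elt \<Rightarrow> real"
  assumes k: "k \<ge> 5"
    and C: "\<And>i. i \<le> k - 1 \<Longrightarrow> s \<le> sum f (C_set k i)"
    and U: "\<And>U. U \<subseteq> E_set k \<Longrightarrow> card U = k \<Longrightarrow> s \<le> sum f U"
    and T: "T \<subseteq> E_set k" "card T = 2 * k - 2"
  shows "(2 * real k - 3) * s \<le> (real k - 1) * sum f T"
proof -
  note E = card_E_set[OF k]
  have fT: "finite T" using T E finite_subset by blast
  have "card (E_set k - T) = 1" using T E k fT by (simp add: card_Diff_subset)
  then obtain e where e: "E_set k - T = {e}" by (metis card_1_singletonE)
  obtain i where i: "i \<le> k - 1" "e \<notin> C_set k i" using missed_by_C_set[OF k] by blast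
  let ?C = "C_set k i"
  note Ci = C_setE[OF k i(1)]
  have CT: "?C \<subseteq> T"
  proof
    fix x assume "x \<in> ?C"
    then have "x \<in> E_set k" "x \<noteq> e" using Ci(1) i(2) by auto
    then show "x \<in> T" using e by (metis DiffI singletonD)
  qed
  have "?C \<noteq> {}" using Ci(2) k by auto
  then have "Min (f ` ?C) \<in> f ` ?C" using Min_in[of "f ` ?C"] Ci(3) by simp
  then obtain u where u: "u \<in> ?C" "f u = Min (f ` ?C)" by (metis imageE)
  then have "of_nat (card ?C) * f u \<le> sum f ?C"
    by (intro sum_bounded_below) (use Ci(3) in auto)
  then have 1: "(real k - 1) * f u \<le> sum f ?C" using Ci(2) k by (simp add: of_nat_diff)
  have "card (insert u (T - ?C)) = k"
    using u CT fT Ci T k by (simp add: card_Diff_subset)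
  moreover have "insert u (T - ?C) \<subseteq> E_set k" using u Ci T by auto
  ultimately have 2: "s \<le> f u + sum f (T - ?C)" using U[of "insert u (T - ?C)"] u fT by simp
  have 3: "sum f T = sum f ?C + sum f (T - ?C)"
    using sum.subset_diff[OF CT fT] by (simp add: add.commute)
  \<comment> \<open>The two lower bounds on \<open>sum f C\<close> agree at
    \<open>f u = s / (k - 1)\<close>, where the constant \<open>(2 * k - 3) / (k - 1)\<close>
    arises. Up to this value the bound \<open>s\<close> is used, beyond it
    \<open>(k - 1) * f u\<close>.\<close>
  show ?thesis
  proof (cases "(real k - 1) * f u \<le> s")
    case True
    have "2 * s - f u \<le> sum f T" using C[OF i(1)] 2 3 by linarith
    then have "(real k - 1) * (2 * s - f u) \<le> (real k - 1) * sum f T" using k by (intro mult_left_mono) auto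
    then show ?thesis using True by (simp add: algebra_simps)
  next
    case False
    have "(real k - 1) * f u + (s - f u) \<le> sum f T" using 1 2 3 by linarith
    then have "(real k - 1) * ((real k - 1) * f u + (s - f u)) \<le> (real k - 1) * sum f T"
      using k by (intro mult_left_mono) auto
    moreover have "(real k - 2) * s \<le> (real k - 2) * ((real k - 1) * f u)"
      using k False by (intro mult_left_mono) auto
    ultimately show ?thesis by (simp add: algebra_simps)
  qed
qed

section \<open>Orbits of the rotation and sums over the circuit-hyperplanes\<close>

definition parity_class :: "nat \<Rightarrow> bool \<Rightarrow> nat set" where
  "parity_class k b = {j \<in> {1..2*k-4}. odd j = b}"

lemma parity_class_image:
  assumes "k \<ge> 5"
  shows "parity_class k True = (\<lambda>j. 2*j-1) ` {1..k-2}" "parity_class k False = (\<lambda>j. 2*j) ` {1..k-2}"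
proof -
  show "parity_class k True = (\<lambda>j. 2*j-1) ` {1..k-2}"
  proof (intro equalityI subsetI)
    fix j assume "j \<in> parity_class k True"
    then have j: "odd j" "j \<le> 2*k-4" by (auto simp: parity_class_def)
    then obtain l where "j = 2*l+1" by (auto elim: oddE)
    then show "j \<in> (\<lambda>j. 2*j-1) ` {1..k-2}" using j by (intro image_eqI[of _ _ "Suc l"]) auto
  qed (use assms in \<open>auto simp: parity_class_def\<close>)
  show "parity_class k False = (\<lambda>j. 2*j) ` {1..k-2}"
  proof (intro equalityI subsetI)
    fix j assume "j \<in> parity_class k False"
    then have j: "even j" "j \<ge> 1" "j \<le> 2*k-4" by (auto simp: parity_class_def)
    then obtain l where "j = 2*l" by (auto elim: evenE)
    then show "j \<in> (\<lambda>j. 2*j) ` {1..k-2}" using j by (intro image_eqI[of _ _ l]) auto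
  qed (use assms in \<open>auto simp: parity_class_def\<close>)
qed

lemma card_parity_class:
  assumes "k \<ge> 5"
  shows "card (parity_class k b) = k - 2"
proof -
  have inj: "inj_on (\<lambda>j::nat. 2*j-1) {1..k-2}" "inj_on (\<lambda>j::nat. 2*j) {1..k-2}"
    by (auto intro!: inj_onI)
  have "card (parity_class k True) = k - 2" "card (parity_class k False) = k - 2"
    unfolding parity_class_image[OF assms] card_image[OF inj(1)] card_image[OF inj(2)] by simp_all
  then show ?thesis by (cases b) simp_all
qed

text \<open>Since \<open>gamma\<close> moves cyclically by 2, its orbits are the two parity classes.
  Two of the first \<open>k - 2\<close> iterates coincide only if \<open>k - 2\<close> divides the
  difference of their indices, so these iterates are distinct and fill a class of
  \<open>k - 2\<close> points.\<close>

lemma gamma_orbit: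
  assumes k: "k \<ge> 5" and l: "l \<in> {1..2*k-4}"
  shows "bij_betw (\<lambda>i. (gamma k ^^ i) l) {..<k-2} (parity_class k (odd l))"
proof -
  have N: "2*k-4 = 2*(k-2)" by simp
  have val: "(gamma k ^^ i) l = (l - 1 + 2 * i) mod (2*(k-2)) + 1" for i
    using gamma_pow_eq[OF l, of i] unfolding N .
  have inj: "inj_on (\<lambda>i. (gamma k ^^ i) l) {..<k-2}"
  proof (rule linorder_inj_onI')
    fix i j assume ij: "i \<in> {..<k-2}" "j \<in> {..<k-2}" "i < j"
    show "(gamma k ^^ i) l \<noteq> (gamma k ^^ j) l"
    proof
      assume "(gamma k ^^ i) l = (gamma k ^^ j) l"
      then have "(l - 1 + 2 * j) mod (2*(k-2)) = (l - 1 + 2 * i) mod (2*(k-2))" by (simp add: val)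
      then have "2 * (k-2) dvd (l - 1 + 2 * j) - (l - 1 + 2 * i)"
        using ij by (subst (asm) mod_eq_dvd_iff_nat) auto
      moreover have "(l - 1 + 2 * j) - (l - 1 + 2 * i) = 2 * (j - i)" using ij by simp
      ultimately have "k - 2 dvd j - i" by simp
      then show False using ij dvd_imp_le[of "k-2" "j-i"] by auto
    qed
  qed
  have sub: "(\<lambda>i. (gamma k ^^ i) l) ` {..<k-2} \<subseteq> parity_class k (odd l)"
  proof (rule image_subsetI)
    fix i assume "i \<in> {..<k-2}"
    have "(l - 1 + 2 * i) mod (2*(k-2)) < 2*(k-2)" using k by simp
    moreover have "even ((l - 1 + 2 * i) mod (2*(k-2))) = even (l - 1)"
      by (simp add: dvd_mod_iff)
    moreover have "even (l - 1) = odd l" using l by simp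
    ultimately show "(gamma k ^^ i) l \<in> parity_class k (odd l)"
      unfolding val parity_class_def by auto
  qed
  have "(\<lambda>i. (gamma k ^^ i) l) ` {..<k-2} = parity_class k (odd l)"
  proof (rule card_subset_eq[OF _ sub])
    show "card ((\<lambda>i. (gamma k ^^ i) l) ` {..<k-2}) = card (parity_class k (odd l))"
      unfolding card_image[OF inj] card_parity_class[OF k] by simp
  qed (simp add: parity_class_def)
  then show ?thesis using inj by (simp add: bij_betw_def)
qed

text \<open>After interchanging the sums, each \<open>l\<close> in \<open>{1..k-3}\<close>
  contributes one full orbit, i.e. the whole class of its parity; \<open>p\<close> and
  \<open>q\<close> count the odd and the even starting points.\<close>

lemma sum_over_X_sets:
  fixes g :: "nat \<Rightarrow> real"
  assumes k: "k \<ge> 5"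
  obtains p q :: nat where "p + q = k - 3"
    "(\<Sum>i<k-2. sum g (X_set k i)) = p * sum g (parity_class k True) + q * sum g (parity_class k False)"
proof
  let ?p = "card ({1..k-3} \<inter> {l. odd l})" and ?q = "card ({1..k-3} \<inter> - {l. odd l})"
  show "?p + ?q = k - 3"
    using card_Int_Diff[of "{1..k-3}" "{l. odd l}"] by (simp add: Diff_eq)
  have "sum g (X_set k i) = (\<Sum>l\<in>{1..k-3}. g ((gamma k ^^ i) l))" for i
    unfolding X_set_def by (rule sum.reindex_cong[OF inj_on_subset[OF bij_is_inj[OF gamma_pow_bij]]]) auto
  then have "(\<Sum>i<k-2. sum g (X_set k i)) = (\<Sum>i<k-2. \<Sum>l\<in>{1..k-3}. g ((gamma k ^^ i) l))"
    by (simp only:)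
  also have "\<dots> = (\<Sum>l\<in>{1..k-3}. \<Sum>i<k-2. g ((gamma k ^^ i) l))"
    by (rule sum.swap)
  also have "\<dots> = (\<Sum>l\<in>{1..k-3}. if odd l then sum g (parity_class k True) else sum g (parity_class k False))"
  proof (rule sum.cong)
    fix l assume "l \<in> {1..k-3}"
    then have "l \<in> {1..2*k-4}" using k by auto
    from sum.reindex_bij_betw[OF gamma_orbit[OF k this], of g]
    show "(\<Sum>i<k-2. g ((gamma k ^^ i) l)) =
      (if odd l then sum g (parity_class k True) else sum g (parity_class k False))" by simp
  qed simp
  also have "\<dots> = ?p * sum g (parity_class k True) + ?q * sum g (parity_class k False)"
    by (simp add: sum.If_cases)
  finally show "(\<Sum>i<k-2. sum g (X_set k i)) =
    ?p * sum g (parity_class k True) + ?q * sum g (parity_class k False)" .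
qed

lemma sum_C_set:
  fixes f :: "elt \<Rightarrow> 'b::comm_monoid_add"
  assumes k: "k \<ge> 5"
  shows "i \<le> k - 3 \<Longrightarrow> sum f (C_set k i) = f Pa + f Pb + (\<Sum>j\<in>X_set k i. f (Num j))"
    and "sum f (C_set k (k-2)) = f Pc + (\<Sum>j\<in>parity_class k True. f (Num j))"
    and "sum f (C_set k (k-1)) = f Pc + (\<Sum>j\<in>parity_class k False. f (Num j))"
proof -
  have inj: "inj_on Num A" for A by (simp add: inj_on_def)
  have fin: "finite (parity_class k b)" for b by (simp add: parity_class_def)
  have img: "sum f (Num ` A) = (\<Sum>j\<in>A. f (Num j))" for A by (simp add: sum.reindex[OF inj])
  have notin: "Pa \<notin> Num ` A" "Pb \<notin> Num ` A" "Pc \<notin> Num ` A" for A by auto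
  show "sum f (C_set k i) = f Pa + f Pb + (\<Sum>j\<in>X_set k i. f (Num j))" if "i \<le> k - 3"
  proof -
    have "C_set k i = insert Pa (insert Pb (Num ` X_set k i))" using that by (simp add: C_set_def)
    then show ?thesis using X_set_range(3)[OF k, of i] notin by (simp add: img add.assoc)
  qed
  have "C_set k (k-2) = insert Pc (Num ` parity_class k True)"
    unfolding parity_class_image[OF k] image_image using k by (auto simp: C_set_def)
  then show "sum f (C_set k (k-2)) = f Pc + (\<Sum>j\<in>parity_class k True. f (Num j))"
    using fin notin by (simp add: img)
  have "k - 1 \<noteq> k - 2" "\<not> k - 1 \<le> k - 3" using k by auto
  then have "C_set k (k-1) = insert Pc (Num ` parity_class k False)"
    unfolding parity_class_image[OF k] image_image by (auto simp: C_set_def)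
  then show "sum f (C_set k (k-1)) = f Pc + (\<Sum>j\<in>parity_class k False. f (Num j))"
    using fin notin by (simp add: img)
qed

lemma sum_E_set:
  fixes f :: "elt \<Rightarrow> 'b::comm_monoid_add"
  shows "sum f (E_set k) = f Pa + (f Pb + (f Pc + (\<Sum>j\<in>{1..2*k-4}. f (Num j))))"
proof -
  have "E_set k = insert Pa (insert Pb (insert Pc (Num ` {1..2*k-4})))" by (auto simp: E_set_def)
  moreover have "sum f (Num ` {1..2*k-4}) = (\<Sum>j\<in>{1..2*k-4}. f (Num j))"
    by (subst sum.reindex) (auto simp: inj_on_def)
  ultimately show ?thesis by (auto simp: image_iff)
qed

lemma sum_parity_classes:
  fixes g :: "nat \<Rightarrow> 'b::comm_monoid_add"
  shows "sum g {1..2*k-4} = sum g (parity_class k True) + sum g (parity_class k False)"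
proof -
  have "{1..2*k-4} = parity_class k True \<union> parity_class k False" by (auto simp: parity_class_def)
  moreover have "parity_class k True \<inter> parity_class k False = {}" "finite (parity_class k b)" for b
    by (auto simp: parity_class_def)
  ultimately show ?thesis by (simp only: sum.union_disjoint)
qed

text \<open>Averaging \<open>C_0, ..., C_{k-3}\<close> over the rotation and adding suitable multiples of the last two
  circuit-hyperplanes gives every numbered element the same weight; \<open>k\<close>-subsets of the numbered elements
  account for the rest.\<close>

lemma sum_E_set_lower:
  fixes f :: "elt \<Rightarrow> real"
  assumes k: "k \<ge> 5"
    and C: "\<And>i. i \<le> k - 1 \<Longrightarrow> s \<le> sum f (C_set k i)"
    and U: "\<And>U. U \<subseteq> E_set k \<Longrightarrow> card U = k \<Longrightarrow> s \<le> sum f U"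
  shows "(2 * real k + 1) * s \<le> k * sum f (E_set k)"
proof -
  define g where "g j = f (Num j)" for j
  define a b c x y where "a = f Pa" and "b = f Pb" and "c = f Pc"
    and "x = sum g (parity_class k True)" and "y = sum g (parity_class k False)"
  obtain p q :: nat where pq: "p + q = k - 3"
    "(\<Sum>i<k-2. sum g (X_set k i)) = p * x + q * y"
    using sum_over_X_sets[OF k, of g] unfolding x_def y_def by metis
  have pq': "real p + real q = real k - 3" 
    using arg_cong[OF pq(1), of real] k by (simp add: of_nat_diff)
  have "(\<Sum>i<k-2. s) \<le> (\<Sum>i<k-2. a + b + sum g (X_set k i))"
  proof (rule sum_mono)
    fix i assume "i \<in> {..<k-2}"
    then have i: "i \<le> k - 3" by auto
    then show "s \<le> a + b + sum g (X_set k i)"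
      using C[of i] sum_C_set(1)[OF k i, of f] by (simp add: a_def b_def g_def)
  qed
  then have 1: "(real k - 2) * s \<le> (real k - 2) * (a + b) + (p * x + q * y)"
    using k pq(2) by (simp add: sum.distrib of_nat_diff algebra_simps)
  have 2: "s \<le> c + x" using C[of "k-2"] sum_C_set(2)[OF k, of f] by (simp add: c_def x_def g_def)
  have 3: "s \<le> c + y" using C[of "k-1"] sum_C_set(3)[OF k, of f] by (simp add: c_def y_def g_def)
  have tot: "sum f (E_set k) = a + b + c + (x + y)"
    using sum_parity_classes[of g k] unfolding sum_E_set a_def b_def c_def x_def y_def g_def
    by (simp add: add.assoc)
  have "s * card (Num ` {1..2*k-4}) \<le> k * sum f (Num ` {1..2*k-4})"
  proof (rule sum_subset_average)
    show "k \<le> card (Num ` {1..2*k-4})" using k by (simp add: card_image inj_on_def)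
    show "s \<le> sum f V" if "V \<subseteq> Num ` {1..2*k-4}" "card V = k" for V
      using U[of V] that by (auto simp: E_set_def)
  qed (use k in auto)
  moreover have "sum f (Num ` {1..2*k-4}) = x + y"
    unfolding x_def y_def sum_parity_classes[symmetric] g_def
    by (subst sum.reindex) (auto simp: inj_on_def)
  ultimately have 4: "(2 * real k - 4) * s \<le> k * (x + y)"
    using k by (simp add: card_image inj_on_def of_nat_diff mult.commute)
  \<comment> \<open>Added to twice the inequality 1, these multiples of 2 and 3 give all numbered
    points the same weight \<open>2 * k - 5\<close>, while \<open>a\<close>, \<open>b\<close> and
    \<open>c\<close> receive \<open>2 * k - 4\<close>. The multipliers are nonnegative because
    \<open>p\<close> and \<open>q\<close> are at most \<open>k - 3\<close>.\<close>
  have p: "0 \<le> 2 * real k - 5 - 2 * p" "0 \<le> 2 * real k - 5 - 2 * q" using pq' by simp_all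
  have "(2 * real k - 5 - 2 * p) * s \<le> (2 * real k - 5 - 2 * p) * (c + x)"
    "(2 * real k - 5 - 2 * q) * s \<le> (2 * real k - 5 - 2 * q) * (c + y)"
    using mult_left_mono[OF 2 p(1)] mult_left_mono[OF 3 p(2)] .
  moreover have "(2 * real k - 5 - 2 * p) * (c + x) + (2 * real k - 5 - 2 * q) * (c + y) =
      (2 * (2 * real k - 5) - 2 * (real p + real q)) * c + (2 * real k - 5) * (x + y) - 2 * (p * x + q * y)"
    by (simp add: algebra_simps)
  moreover have "(2 * real k - 5 - 2 * p) * s + (2 * real k - 5 - 2 * q) * s =
      (2 * (2 * real k - 5) - 2 * (real p + real q)) * s"
    by (simp add: algebra_simps)
  ultimately have "(2 * real k - 4) * s + 2 * ((real k - 2) * s)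
      \<le> (2 * real k - 4) * c + (2 * real k - 5) * (x + y) + 2 * ((real k - 2) * (a + b))"
    using 1 unfolding pq' by (simp add: algebra_simps)
  \<comment> \<open>Adding \<open>x + y\<close> makes all weights equal; its lower bound 4 then
    supplies the extra \<open>s / k\<close> in the constant.\<close>
  then have 5: "(2 * real k - 4) * (2 * s) + (x + y) \<le> (2 * real k - 4) * (a + b + c + (x + y))"
    by (simp add: algebra_simps)
  have "k * ((2 * real k - 4) * (2 * s) + (x + y)) \<le> k * ((2 * real k - 4) * (a + b + c + (x + y)))"
    using 5 by (rule mult_left_mono) simp
  then have "(2 * real k - 4) * ((2 * real k + 1) * s) \<le> (2 * real k - 4) * (k * sum f (E_set k))"
    using 4 unfolding tot by (simp add: algebra_simps)
  moreover have "2 * real k - 4 > 0" using k by simp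
  ultimately show ?thesis by (simp only: mult_le_cancel_left_pos)
qed

text \<open>The hypothesis on \<open>q\<close> is dictated by the sets with \<open>2 * k - 2\<close>
  points. Smaller sets are settled by averaging over \<open>k\<close>-subsets, the ground set by its
  weighted bound.\<close>

lemma sum_lower:
  fixes f :: "elt \<Rightarrow> real"
  assumes k: "k \<ge> 5"
    and C: "\<And>i. i \<le> k - 1 \<Longrightarrow> s \<le> sum f (C_set k i)"
    and U: "\<And>U. U \<subseteq> E_set k \<Longrightarrow> card U = k \<Longrightarrow> s \<le> sum f U"
    and s: "0 \<le> s" and q: "q * (real k - 1)\<^sup>2 \<le> s * (2 * real k - 3)"
    and T: "T \<subseteq> E_set k" "k \<le> card T"
  shows "q * (card T - real k + 1) \<le> sum f T"
proof -
  note E = card_E_set[OF k]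
  have fT: "finite T" using T E finite_subset by blast
  have "card T \<le> 2 * k - 1" using card_mono[of "E_set k" T] T E by simp
  then consider "card T \<le> 2 * k - 3" | "card T = 2 * k - 2" | "card T = 2 * k - 1" by linarith
  then show ?thesis
  proof cases
    case 1
    define t where "t = real (card T)"
    have t: "real k \<le> t" "t \<le> 2 * real k - 3" using 1 T(2) k unfolding t_def by linarith+
    have avg: "s * t \<le> k * sum f T" unfolding t_def
      by (rule sum_subset_average) (use k fT T U in auto)
    have "(real k - 1)\<^sup>2 * (k * (q * (t - k + 1))) = (k * (t - k + 1)) * (q * (real k - 1)\<^sup>2)" by simp
    also have "\<dots> \<le> (k * (t - k + 1)) * (s * (2 * real k - 3))"
      using q by (rule mult_left_mono) (use t in simp)
    \<comment> \<open>The subtracted term is the slack of the averaging bound;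
      \<open>t \<le> 2 * k - 3\<close> keeps its second summand nonnegative.\<close>
    also have "\<dots> = s * (t * (real k - 1)\<^sup>2 - ((2 * real k - 3) + (2 * real k - 3 - t) * (real k * (real k - 1) - 1)))"
      by (simp add: algebra_simps power2_eq_square)
    also have "\<dots> \<le> s * (t * (real k - 1)\<^sup>2)"
    proof (rule mult_left_mono[OF _ s])
      have "1 * 1 \<le> real k * (real k - 1)" using k by (intro mult_mono) auto
      then have "0 \<le> (2 * real k - 3 - t) * (real k * (real k - 1) - 1)"
        using t by (intro mult_nonneg_nonneg) auto
      then show "t * (real k - 1)\<^sup>2 - ((2 * real k - 3) + (2 * real k - 3 - t) * (real k * (real k - 1) - 1))
          \<le> t * (real k - 1)\<^sup>2" using k by simp
    qed
    also have "\<dots> = (real k - 1)\<^sup>2 * (s * t)" by simp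
    also have "\<dots> \<le> (real k - 1)\<^sup>2 * (k * sum f T)" using avg by (rule mult_left_mono) simp
    finally have "(real k - 1)\<^sup>2 * (k * (q * (t - k + 1))) \<le> (real k - 1)\<^sup>2 * (k * sum f T)" .
    moreover have "(real k - 1)\<^sup>2 > 0" "real k > 0" using k by simp_all
    ultimately show ?thesis by (simp only: mult_le_cancel_left_pos t_def)
  next
    case 2
    have "(real k - 1) * (q * (real k - 1)) = q * (real k - 1)\<^sup>2" by (simp add: power2_eq_square)
    also have "\<dots> \<le> (2 * real k - 3) * s" using q by (simp only: mult.commute)
    also have "\<dots> \<le> (real k - 1) * sum f T" by (rule sum_without_point[OF k C U T(1) 2])
    finally have "(real k - 1) * (q * (real k - 1)) \<le> (real k - 1) * sum f T" .
    moreover have "real k - 1 > 0" using k by simp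
    ultimately have "q * (real k - 1) \<le> sum f T" by (simp only: mult_le_cancel_left_pos)
    moreover have "real (card T) - real k + 1 = real k - 1" using 2 k by (simp add: of_nat_diff)
    ultimately show ?thesis by (simp only:)
  next
    case 3
    then have TE: "T = E_set k" using E T(1) by (intro card_subset_eq) auto
    have "(real k * (real k - 1)\<^sup>2) * (q * k) = k\<^sup>2 * (q * (real k - 1)\<^sup>2)" by (simp add: power2_eq_square)
    also have "\<dots> \<le> k\<^sup>2 * (s * (2 * real k - 3))" using q by (rule mult_left_mono) simp
    \<comment> \<open>\<open>k^2 * (2 * k - 3)\<close> and \<open>(k - 1)^2 * (2 * k + 1)\<close>
      differ by exactly 1, so the ground set is barely less restrictive than the sets with
      \<open>2 * k - 2\<close> points.\<close>
    also have "\<dots> = s * ((real k - 1)\<^sup>2 * (2 * real k + 1) - 1)" by (simp add: algebra_simps power2_eq_square)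
    also have "\<dots> \<le> s * ((real k - 1)\<^sup>2 * (2 * real k + 1))" using s by (intro mult_left_mono) auto
    also have "\<dots> = (real k - 1)\<^sup>2 * ((2 * real k + 1) * s)" by simp
    also have "\<dots> \<le> (real k - 1)\<^sup>2 * (k * sum f (E_set k))"
      using sum_E_set_lower[OF k C U] by (intro mult_left_mono zero_le_power2)
    finally have "(real k * (real k - 1)\<^sup>2) * (q * k) \<le> (real k * (real k - 1)\<^sup>2) * sum f (E_set k)"
      by (simp add: algebra_simps)
    moreover have "real k * (real k - 1)\<^sup>2 > 0" using k by simp
    ultimately have "q * k \<le> sum f (E_set k)" by (simp only: mult_le_cancel_left_pos)
    moreover have "real (card T) - real k + 1 = real k" using 3 k by (simp add: of_nat_diff)
    ultimately show ?thesis unfolding TE by (simp only:)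
  qed
qed

section \<open>Symbolic and ordinary powers of $I(M_{k,2k-1})$\<close>

text \<open>Lattice points of the symbolic polyhedron scaled by \<open>s\<close>; the covers listed
  here include all minimal ones.\<close>

definition symbolic_vector :: "nat \<Rightarrow> nat \<Rightarrow> (elt \<Rightarrow> nat) \<Rightarrow> bool" where
  "symbolic_vector k s m \<longleftrightarrow> (\<forall>i\<le>k-1. s \<le> sum m (C_set k i)) \<and>
    (\<forall>U. U \<subseteq> E_set k \<longrightarrow> card U = k \<longrightarrow> s \<le> sum m U)"

lemma symbolic_vector_real:
  assumes "symbolic_vector k s m"
  shows "i \<le> k - 1 \<Longrightarrow> real s \<le> (\<Sum>v\<in>C_set k i. real (m v))"
    and "U \<subseteq> E_set k \<Longrightarrow> card U = k \<Longrightarrow> real s \<le> (\<Sum>v\<in>U. real (m v))"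
  using assms unfolding symbolic_vector_def of_nat_sum[symmetric] of_nat_le_iff by blast+

text \<open>Points of value at least \<open>q\<close> contribute \<open>q\<close> each to the
  truncated sum. If \<open>T\<close> consists of the other points, the packing condition becomes a
  lower bound \<open>q * (card T - k + 1)\<close> on the weight of \<open>T\<close>, which is
  trivial for fewer than \<open>k\<close> points and otherwise a linear inequality valid on the
  symbolic polyhedron.\<close>

lemma pack_bases:
  fixes m :: "elt \<Rightarrow> nat"
  assumes k: "k \<ge> 5" and m: "symbolic_vector k s m"
    and q: "real q * (real k - 1)\<^sup>2 \<le> real s * (2 * real k - 3)"
  shows "\<exists>Bs. size Bs = q \<and> set_mset Bs \<subseteq> bases (M_matroid k) \<and> (\<forall>v. load Bs v \<le> m v)"
proof -
  note E = card_E_set[OF k]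
  \<comment> \<open>This square shows that \<open>2 * k - 3\<close> is at most
    \<open>(k - 1)^2\<close>, hence \<open>q \<le> s\<close>, and the bounds at the
    circuit-hyperplanes carry over from \<open>s\<close> to \<open>q\<close>.\<close>
  have "0 \<le> (real k - 2)\<^sup>2" by simp
  then have "2 * real k - 3 \<le> (real k - 1)\<^sup>2" by (simp add: power2_eq_square algebra_simps)
  then have "real s * (2 * real k - 3) \<le> real s * (real k - 1)\<^sup>2" by (rule mult_left_mono) simp
  then have "real q * (real k - 1)\<^sup>2 \<le> real s * (real k - 1)\<^sup>2" using q by linarith
  moreover have "(real k - 1)\<^sup>2 > 0" using k by simp
  ultimately have qs: "q \<le> s" by (simp only: mult_le_cancel_right_pos of_nat_le_iff)
  have low: "q \<le> (\<Sum>v\<in>E_set k - D. m v)" if "D \<in> D_sets k" for D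
  proof -
    obtain i where i: "i \<le> k - 1" "D = E_set k - C_set k i" using \<open>D \<in> D_sets k\<close> by (auto simp: D_sets_def)
    then have "E_set k - D = C_set k i" using C_setE(1)[OF k i(1)] by blast
    moreover have "s \<le> sum m (C_set k i)" using m i(1) by (simp add: symbolic_vector_def)
    ultimately show ?thesis using qs by simp
  qed
  have tot: "q * k \<le> (\<Sum>v\<in>E_set k. min (m v) q)"
  proof -
    let ?T = "{v \<in> E_set k. m v < q}"
    have fT: "finite ?T" "?T \<subseteq> E_set k" using E by auto
    have "(\<Sum>v\<in>E_set k. min (m v) q) = (\<Sum>v\<in>E_set k - ?T. min (m v) q) + (\<Sum>v\<in>?T. min (m v) q)"
      using E by (intro sum.subset_diff) auto
    also have "(\<Sum>v\<in>?T. min (m v) q) = (\<Sum>v\<in>?T. m v)" by (rule sum.cong) auto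
    also have "(\<Sum>v\<in>E_set k - ?T. min (m v) q) = (\<Sum>v\<in>E_set k - ?T. q)" by (rule sum.cong) auto
    also have "\<dots> = (2 * k - 1 - card ?T) * q" using E fT by (simp add: card_Diff_subset)
    finally have split: "(\<Sum>v\<in>E_set k. min (m v) q) = (2 * k - 1 - card ?T) * q + (\<Sum>v\<in>?T. m v)" .
    show ?thesis
    proof (cases "k \<le> card ?T")
      case False
      then have "k \<le> 2 * k - 1 - card ?T" by linarith
      then have "k * q \<le> (2 * k - 1 - card ?T) * q" by (rule mult_le_mono1)
      then show ?thesis unfolding split by (simp only: mult.commute[of q k] trans_le_add1)
    next
      case True
      have "card ?T \<le> 2 * k - 1" using card_mono[OF _ fT(2)] E by simp
      then have "real ((2 * k - 1 - card ?T) * q) = (2 * real k - 1 - real (card ?T)) * real q"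
        using k by (simp add: of_nat_diff)
      moreover have "real q * (real (card ?T) - real k + 1) \<le> (\<Sum>v\<in>?T. real (m v))"
        by (rule sum_lower[OF k symbolic_vector_real[OF m] _ q fT(2) True]) simp_all
      ultimately have "real q * real k \<le> real ((2 * k - 1 - card ?T) * q) + (\<Sum>v\<in>?T. real (m v))"
        by (simp add: algebra_simps)
      then have "real (q * k) \<le> real ((2 * k - 1 - card ?T) * q + (\<Sum>v\<in>?T. m v))"
        by (simp only: of_nat_mult of_nat_add of_nat_sum)
      then show ?thesis unfolding split by (simp only: of_nat_le_iff)
    qed
  qed
  have "\<exists>Bs. size Bs = q \<and> (\<forall>B\<in>#Bs. B \<subseteq> E_set k \<and> card B = k \<and> B \<notin> D_sets k) \<and> (\<forall>v. load Bs v \<le> m v)"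
    by (rule pack_sparse_paving_bases[OF _ _ _ D_sets_card[OF k] D_sets_Int[OF k] low tot]) (use E k in auto)
  then show ?thesis unfolding bases_M_matroid[OF k] by blast
qed

fun elt_code :: "elt \<Rightarrow> nat" where
  "elt_code Pa = 0" | "elt_code Pb = 1" | "elt_code Pc = 2" | "elt_code (Num n) = n + 3"

lemma elt_code_inject: "elt_code x = elt_code y \<Longrightarrow> x = y"
  by (cases x; cases y) simp_all

text \<open>Any linear order on the variables makes the polynomial ring an instance of \<open>idom\<close>.\<close>

instantiation elt :: linorder
begin

definition "x \<le> y \<longleftrightarrow> elt_code x \<le> elt_code y"
definition "x < y \<longleftrightarrow> elt_code x < elt_code y"

instance
  by standard (auto simp: less_eq_elt_def less_elt_def intro: elt_code_inject)

end

lemma M_matroid_finite: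
  assumes "k \<ge> 5"
  shows "finite (ground (M_matroid k))" "bases (M_matroid k) \<subseteq> Pow (ground (M_matroid k))"
  using card_E_set[OF assms] by (auto simp: ground_M_matroid bases_M_matroid[OF assms])

text \<open>Every cover contains a circuit-hyperplane or a \<open>k\<close>-set, and exponent sums
  only grow with the cover, so these two kinds decide membership.\<close>

lemma symbolic_power_M_matroid:
  assumes k: "k \<ge> 5"
  shows "symbolic_power (poly_ring (ground (M_matroid k))) (facet_ideal (M_matroid k) :: (elt, 'a::field) mpoly set) s =
    mono_ideal (E_set k) {m. symbolic_vector k s (Poly_Mapping.lookup m)}"
  unfolding symbolic_power_facet_ideal[OF M_matroid_finite[OF k]] unfolding ground_M_matroid
proof (rule mono_ideal_cong, unfold mem_Collect_eq, intro iffI)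
  fix m :: "elt \<Rightarrow>\<^sub>0 nat"
  assume "\<forall>T. vertex_cover (M_matroid k) T \<longrightarrow> s \<le> msum m T"
  then show "symbolic_vector k s (Poly_Mapping.lookup m)"
    unfolding symbolic_vector_def using vertex_cover_C_set[OF k] vertex_cover_large[OF k] by blast
next
  fix m :: "elt \<Rightarrow>\<^sub>0 nat"
  assume m: "symbolic_vector k s (Poly_Mapping.lookup m)"
  show "\<forall>T. vertex_cover (M_matroid k) T \<longrightarrow> s \<le> msum m T"
  proof (intro allI impI)
    fix T assume T: "vertex_cover (M_matroid k) T"
    then have fT: "finite T"
      using card_E_set[OF k] finite_subset unfolding vertex_cover_def ground_M_matroid by blast
    have "\<exists>W\<subseteq>T. s \<le> msum m W"
      using vertex_cover_cases[OF k T] m unfolding symbolic_vector_def by metis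
    then obtain W where "W \<subseteq> T" "s \<le> msum m W" by blast
    moreover have "msum m W \<le> msum m T" using fT \<open>W \<subseteq> T\<close> by (intro sum_mono2) auto
    ultimately show "s \<le> msum m T" by simp
  qed
qed

lemma ideal_power_M_matroid:
  assumes k: "k \<ge> 5"
  shows "ideal_power (poly_ring (ground (M_matroid k))) (facet_ideal (M_matroid k) :: (elt, 'a::field) mpoly set) q =
    mono_ideal (E_set k) {m. \<exists>Bs. size Bs = q \<and> set_mset Bs \<subseteq> bases (M_matroid k) \<and>
      (\<forall>v. load Bs v \<le> Poly_Mapping.lookup m v)}"
  using ideal_power_facet_ideal[OF M_matroid_finite[OF k], of q] unfolding ground_M_matroid .

lemma symbolic_power_subset_ideal_power:
  assumes k: "k \<ge> 5" and q: "real q * (real k - 1)\<^sup>2 \<le> real s * (2 * real k - 3)"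
  shows "symbolic_power (poly_ring (ground (M_matroid k))) (facet_ideal (M_matroid k) :: (elt, 'a::field) mpoly set) s
    \<subseteq> ideal_power (poly_ring (ground (M_matroid k))) (facet_ideal (M_matroid k)) q"
  unfolding symbolic_power_M_matroid[OF k] ideal_power_M_matroid[OF k]
  by (rule mono_ideal_mono) (use pack_bases[OF k _ q] in blast)

section \<open>Monomials with prescribed exponents\<close>

definition vector_monom :: "'v set \<Rightarrow> ('v \<Rightarrow> nat) \<Rightarrow> 'v \<Rightarrow>\<^sub>0 nat" where
  "vector_monom V f = (\<Sum>v\<in>V. Poly_Mapping.single v (f v))"

lemma lookup_vector_monom:
  assumes "finite V"
  shows "Poly_Mapping.lookup (vector_monom V f) v = (if v \<in> V then f v else 0)"
  using assms by (simp add: vector_monom_def lookup_sum lookup_single when_def)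

lemma keys_vector_monom:
  assumes "finite V"
  shows "Poly_Mapping.keys (vector_monom V f) \<subseteq> V"
proof
  fix v assume "v \<in> Poly_Mapping.keys (vector_monom V f)"
  then show "v \<in> V" unfolding in_keys_iff lookup_vector_monom[OF assms] by (simp split: if_splits)
qed

lemma msum_vector_monom:
  assumes "finite V" "T \<subseteq> V"
  shows "msum (vector_monom V f) T = sum f T"
  by (rule sum.cong) (use assms lookup_vector_monom[OF assms(1)] in auto)

lemma mono_degree_eq:
  assumes "finite V" "Poly_Mapping.keys m \<subseteq> V"
  shows "mono_degree m = msum m V"
  unfolding mono_degree_def using assms
  by (intro sum.mono_neutral_left) (auto simp: in_keys_iff)

lemma symbolic_vector_monom:
  assumes k: "k \<ge> 5"
  shows "symbolic_vector k s (Poly_Mapping.lookup (vector_monom (E_set k) f)) = symbolic_vector k s f"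
proof -
  have "finite (E_set k)" using card_E_set[OF k] by blast
  then show ?thesis
    unfolding symbolic_vector_def using msum_vector_monom C_setE(1)[OF k] by metis
qed

section \<open>The asymptotic resurgence\<close>

text \<open>The witness has exponent \<open>s\<close> at \<open>Pa\<close>, 0 at \<open>Pb\<close>
  and \<open>Z\<close> at the other \<open>2 * k - 3\<close> points. Each basis uses at least
  \<open>k - 1\<close> points besides \<open>Pa\<close>, so \<open>q\<close> packed bases would need
  \<open>q * (k - 1)\<close> units, while only \<open>(2 * k - 3) * Z\<close> are available outside
  \<open>Pa\<close>.\<close>

lemma symbolic_power_not_subset_ideal_power:
  assumes k: "k \<ge> 5" and q: "(2 * k - 3) * (s div (k - 1) + 1) < q * (k - 1)"
  shows "\<not> symbolic_power (poly_ring (ground (M_matroid k))) (facet_ideal (M_matroid k) :: (elt, 'a::field) mpoly set) s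
    \<subseteq> ideal_power (poly_ring (ground (M_matroid k))) (facet_ideal (M_matroid k)) q"
proof
  assume sub: "symbolic_power (poly_ring (ground (M_matroid k))) (facet_ideal (M_matroid k) :: (elt, 'a) mpoly set) s
    \<subseteq> ideal_power (poly_ring (ground (M_matroid k))) (facet_ideal (M_matroid k)) q"
  note E = card_E_set[OF k]
  \<comment> \<open>\<open>Z\<close> is an integer above \<open>s / (k - 1)\<close>; rounding up
    this way costs only a bounded amount.\<close>
  define Z where "Z = s div (k - 1) + 1"
  define f where "f v = (if v = Pa then s else if v = Pb then 0 else Z)" for v
  have f: "f Pa = s" "f Pb = 0" "f Pc = Z" "\<And>j. f (Num j) = Z" by (simp_all add: f_def)
  have "s = (k - 1) * (s div (k - 1)) + s mod (k - 1)" by simp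
  moreover have "s mod (k - 1) < k - 1" using k by simp
  ultimately have Z: "s \<le> (k - 1) * Z" unfolding Z_def distrib_left by linarith
  have "symbolic_vector k s f"
    unfolding symbolic_vector_def
  proof (intro conjI allI impI)
    fix i assume "i \<le> k - 1"
    then consider "i \<le> k - 3" | "i = k - 2" | "i = k - 1" by linarith
    then show "s \<le> sum f (C_set k i)"
    proof cases
      case 1
      then show ?thesis by (simp add: sum_C_set(1)[OF k 1] f)
    next
      case 2
      have "sum f (C_set k i) = Z + (k - 2) * Z" unfolding 2 sum_C_set(2)[OF k] f by (simp add: card_parity_class[OF k])
      also have "\<dots> = (k - 1) * Z" using k by (simp add: mult_Suc[symmetric] Suc_diff_Suc numeral_2_eq_2 del: mult_Suc)
      finally show ?thesis using Z by simp
    next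
      case 3
      have "sum f (C_set k i) = Z + (k - 2) * Z" unfolding 3 sum_C_set(3)[OF k] f by (simp add: card_parity_class[OF k])
      also have "\<dots> = (k - 1) * Z" using k by (simp add: mult_Suc[symmetric] Suc_diff_Suc numeral_2_eq_2 del: mult_Suc)
      finally show ?thesis using Z by simp
    qed
  next
    fix U assume U: "U \<subseteq> E_set k" "card U = k"
    have fU: "finite U" using U E finite_subset by blast
    show "s \<le> sum f U"
    proof (cases "Pa \<in> U")
      case True
      then show ?thesis using member_le_sum[of Pa U f] fU f by simp
    next
      case False
      \<comment> \<open>A \<open>k\<close>-set without \<open>Pa\<close> has at least
        \<open>k - 1\<close> points besides \<open>Pb\<close>, all of value
        \<open>Z\<close>.\<close>
      have "(k - 1) * Z \<le> card (U - {Pb}) * Z" using U(2) fU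
        by (intro mult_le_mono1) (simp add: card_Diff_singleton_if)
      also have "\<dots> = sum f (U - {Pb})"
      proof -
        have "sum f (U - {Pb}) = (\<Sum>v\<in>U - {Pb}. Z)" by (rule sum.cong) (use False in \<open>auto simp: f_def\<close>)
        then show ?thesis by simp
      qed
      also have "\<dots> \<le> sum f U" using fU by (intro sum_mono2) auto
      finally show ?thesis using Z by simp
    qed
  qed
  then have "Poly_Mapping.single (vector_monom (E_set k) f) (1 :: 'a)
      \<in> symbolic_power (poly_ring (ground (M_matroid k))) (facet_ideal (M_matroid k)) s"
    unfolding symbolic_power_M_matroid[OF k] single_in_mono_ideal[OF one_neq_zero] mem_Collect_eq
      symbolic_vector_monom[OF k] using keys_vector_monom E by blast
  with sub have "Poly_Mapping.single (vector_monom (E_set k) f) (1 :: 'a)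
      \<in> ideal_power (poly_ring (ground (M_matroid k))) (facet_ideal (M_matroid k)) q" by blast
  then obtain Bs where Bs: "size Bs = q" "set_mset Bs \<subseteq> bases (M_matroid k)"
      "\<And>v. load Bs v \<le> Poly_Mapping.lookup (vector_monom (E_set k) f) v"
    unfolding ideal_power_M_matroid[OF k] single_in_mono_ideal[OF one_neq_zero] by blast
  let ?A = "E_set k - {Pa}"
  have "q * (k - 1) = (\<Sum>B\<in>#Bs. k - 1)" using Bs(1) by simp
  also have "\<dots> \<le> (\<Sum>B\<in>#Bs. card (B \<inter> ?A))"
  proof (rule sum_mset_mono)
    fix B assume "B \<in># Bs"
    then have B: "B \<subseteq> E_set k" "card B = k" using Bs(2) by (auto simp: bases_M_matroid[OF k])
    then have "B \<inter> ?A = B - {Pa}" by blast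
    then show "k - 1 \<le> card (B \<inter> ?A)" using B E finite_subset[of B "E_set k"] by (simp add: card_Diff_singleton_if)
  qed
  also have "\<dots> = (\<Sum>v\<in>?A. load Bs v)" using E by (intro sum_load[symmetric]) auto
  also have "\<dots> \<le> msum (vector_monom (E_set k) f) ?A" by (rule sum_mono) (rule Bs(3))
  also have "\<dots> = sum f ?A" using E by (intro msum_vector_monom) auto
  also have "\<dots> = (2 * k - 3) * Z"
  proof -
    have "sum f (E_set k) = s + sum f ?A" using sum.remove[of "E_set k" Pa f] E f(1) by (simp add: E_set_def)
    moreover have "sum f (E_set k) = s + (Z + (2 * k - 4) * Z)" by (simp add: sum_E_set f)
    moreover have "Z + (2 * k - 4) * Z = (2 * k - 3) * Z"
    proof -
      have "2 * k - 3 = Suc (2 * k - 4)" using k by linarith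
      then show ?thesis by simp
    qed
    ultimately show ?thesis by linarith
  qed
  finally show False using q unfolding Z_def by linarith
qed

text \<open>For a ratio above the claimed value the containment holds for every \<open>t\<close>, so
  it does not enter the supremum. Below it, positive rationals are dense, and for each of them the
  bounded rounding error in the witness is outgrown for large \<open>t\<close>.\<close>

lemma asymptotic_resurgence_M_matroid:
  assumes k: "k \<ge> 5"
  shows "asymptotic_resurgence (poly_ring (ground (M_matroid k))) (facet_ideal (M_matroid k) :: (elt, 'a::field) mpoly set)
    = ereal ((real k - 1)\<^sup>2 / (2 * real k - 3))"
  unfolding asymptotic_resurgence_def
proof (rule Sup_eqI)
  let ?\<rho> = "(real k - 1)\<^sup>2 / (2 * real k - 3)"
  let ?R = "poly_ring (ground (M_matroid k)) :: (elt, 'a) mpoly ring"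
  let ?I = "facet_ideal (M_matroid k) :: (elt, 'a) mpoly set"
  let ?S = "{ereal (real s / real r) |s r. s > 0 \<and> r > 0 \<and>
     (\<forall>\<^sub>F t in sequentially. \<not> symbolic_power ?R ?I (s * t) \<subseteq> ideal_power ?R ?I (r * t))}"
  have pos: "2 * real k - 3 > 0" using k by simp
  show "x \<le> ereal ?\<rho>" if "x \<in> ?S" for x
  proof -
    obtain s r where x: "x = ereal (real s / real r)" "s > 0" "r > 0"
      "\<forall>\<^sub>F t in sequentially. \<not> symbolic_power ?R ?I (s * t) \<subseteq> ideal_power ?R ?I (r * t)"
      using \<open>x \<in> ?S\<close> by blast
    have "real s * (2 * real k - 3) \<le> real r * (real k - 1)\<^sup>2"
    proof (rule ccontr)
      assume neg: "\<not> ?thesis"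
      have "symbolic_power ?R ?I (s * t) \<subseteq> ideal_power ?R ?I (r * t)" for t
      proof (rule symbolic_power_subset_ideal_power[OF k])
        have "real t * (real r * (real k - 1)\<^sup>2) \<le> real t * (real s * (2 * real k - 3))"
          using neg by (intro mult_left_mono) auto
        then show "real (r * t) * (real k - 1)\<^sup>2 \<le> real (s * t) * (2 * real k - 3)"
          by (simp add: mult.assoc mult.left_commute)
      qed
      then have "\<forall>\<^sub>F t in sequentially. False" using x(4) by simp
      then show False by simp
    qed
    then show ?thesis using x pos by (simp add: field_simps)
  qed
  show "ereal ?\<rho> \<le> y" if y: "\<And>x. x \<in> ?S \<Longrightarrow> x \<le> y" for y
  proof (rule ccontr)
    assume "\<not> ereal ?\<rho> \<le> y"
    then have "y < ereal ?\<rho>" by simp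
    then obtain z where z: "y < ereal z" "z < ?\<rho>" using ereal_dense2 by (metis ereal_less_eq(3) less_ereal.simps(1))
    \<comment> \<open>Taking \<open>max z 0\<close> forces the rational number chosen next to be
      positive, hence \<open>s > 0\<close>.\<close>
    have "max z 0 < ?\<rho>" using z(2) pos k by simp
    then obtain w where w: "w \<in> \<rat>" "max z 0 < w" "w < ?\<rho>" using Rats_dense_in_real by blast
    obtain s r where sr: "r \<noteq> 0" "w = real s / real r"
      using Rats_abs_nat_div_natE[OF w(1)] w(2) by (metis abs_of_pos max_less_iff_conj)
    have s: "s > 0" using w(2) sr by (cases s) auto
    have less: "real s * (2 * real k - 3) < real r * (real k - 1)\<^sup>2"
      using w(3) sr pos by (simp add: field_simps)
    \<comment> \<open>The gap \<open>d\<close> gets multiplied by \<open>t\<close>, whereas the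
      rounding in \<open>?Z\<close> costs at most \<open>(2 * k - 3) * (k - 1)\<close>; comparing
      the two gives the threshold on \<open>t\<close>.\<close>
    define d where "d = real r * (real k - 1)\<^sup>2 - real s * (2 * real k - 3)"
    have d: "d > 0" using less by (simp add: d_def)
    have "\<not> symbolic_power ?R ?I (s * t) \<subseteq> ideal_power ?R ?I (r * t)"
      if t: "real t > (2 * real k - 3) * (real k - 1) / d" for t
    proof (rule symbolic_power_not_subset_ideal_power[OF k])
      let ?Z = "s * t div (k - 1) + 1"
      have "(k - 1) * (s * t div (k - 1)) \<le> s * t" by (rule times_div_less_eq_dividend)
      then have "real ((k - 1) * (s * t div (k - 1))) \<le> real (s * t)" by (simp only: of_nat_le_iff)
      then have Z: "(real k - 1) * real ?Z \<le> real s * real t + (real k - 1)"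
        using k by (simp add: of_nat_diff algebra_simps)
      have "(2 * real k - 3) * (real k - 1) < real t * d" using t d by (simp add: field_simps)
      then have "(2 * real k - 3) * (real s * real t + (real k - 1)) < real r * real t * (real k - 1)\<^sup>2"
        by (simp add: d_def algebra_simps)
      moreover have "(2 * real k - 3) * ((real k - 1) * real ?Z) \<le> (2 * real k - 3) * (real s * real t + (real k - 1))"
        using Z pos by (intro mult_left_mono) auto
      ultimately have "(real k - 1) * ((2 * real k - 3) * real ?Z) < (real k - 1) * (real r * real t * (real k - 1))"
        by (simp add: power2_eq_square mult.assoc mult.left_commute)
      moreover have "real k - 1 > 0" using k by simp
      ultimately have "(2 * real k - 3) * real ?Z < real r * real t * (real k - 1)"
        by (simp only: mult_less_cancel_left_pos)
      moreover have "real (2 * k - 3) = 2 * real k - 3" "real (k - 1) = real k - 1"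
        using k by (simp_all add: of_nat_diff)
      then have "real ((2 * k - 3) * ?Z) = (2 * real k - 3) * real ?Z"
        "real (r * t * (k - 1)) = real r * real t * (real k - 1)"
        by (simp_all only: of_nat_mult)
      ultimately have "real ((2 * k - 3) * ?Z) < real (r * t * (k - 1))" by (simp only:)
      then show "(2 * k - 3) * ?Z < r * t * (k - 1)" by (simp only: of_nat_less_iff)
    qed
    moreover have "\<forall>\<^sub>F t in sequentially. real t > (2 * real k - 3) * (real k - 1) / d"
      using filterlim_real_sequentially unfolding filterlim_at_top_dense by blast
    ultimately have "\<forall>\<^sub>F t in sequentially. \<not> symbolic_power ?R ?I (s * t) \<subseteq> ideal_power ?R ?I (r * t)"
      by (auto elim: eventually_mono)
    then have "ereal w \<in> ?S" using s sr by blast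
    then have "ereal w \<le> y" by (rule y)
    moreover have "ereal z < ereal w" using w(2) by simp
    ultimately show False using z(1) by (meson less_le_trans less_trans less_irrefl)
  qed
qed

section \<open>The Waldschmidt constant\<close>

lemma alpha_mono_ideal_le:
  fixes A :: "('v \<Rightarrow>\<^sub>0 nat) set"
  assumes "m \<in> A" "Poly_Mapping.keys m \<subseteq> V"
  shows "alpha (mono_ideal V A :: ('v, 'a::field) mpoly set) \<le> mono_degree m"
  unfolding alpha_def
proof (rule Least_le, rule bexI)
  show "Poly_Mapping.single m (1 :: 'a) \<in> mono_ideal V A"
    using assms by (simp add: single_in_mono_ideal)
  have "Poly_Mapping.keys (Poly_Mapping.single m (1 :: 'a)) = {m}" by simp
  then show "Poly_Mapping.single m (1 :: 'a) \<noteq> 0 \<and> homogeneous (mono_degree m) (Poly_Mapping.single m (1 :: 'a))"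
    unfolding homogeneous_def by fastforce
qed

text \<open>Any monomial in the support of a homogeneous element of least degree lies in the ideal
  and has that degree; the given \<open>m\<close> ensures that such an element exists.\<close>

lemma alpha_mono_ideal_attained:
  fixes A :: "('v \<Rightarrow>\<^sub>0 nat) set"
  assumes "m \<in> A" "Poly_Mapping.keys m \<subseteq> V"
  obtains n where "n \<in> A" "Poly_Mapping.keys n \<subseteq> V"
    "mono_degree n = alpha (mono_ideal V A :: ('v, 'a::field) mpoly set)"
proof -
  let ?I = "mono_ideal V A :: ('v, 'a) mpoly set"
  let ?P = "\<lambda>d. \<exists>p\<in>?I. p \<noteq> 0 \<and> homogeneous d p"
  have "?P (mono_degree m)"
  proof (rule bexI)
    show "Poly_Mapping.single m (1 :: 'a) \<in> mono_ideal V A"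
      using assms by (simp add: single_in_mono_ideal)
    have "Poly_Mapping.keys (Poly_Mapping.single m (1 :: 'a)) = {m}" by simp
    then show "Poly_Mapping.single m (1 :: 'a) \<noteq> 0 \<and> homogeneous (mono_degree m) (Poly_Mapping.single m (1 :: 'a))"
      unfolding homogeneous_def by fastforce
  qed
  then have "?P (alpha ?I)" unfolding alpha_def by (rule LeastI)
  then obtain p where p: "p \<in> ?I" "p \<noteq> 0" "homogeneous (alpha ?I) p" by blast
  then obtain n where "n \<in> Poly_Mapping.keys p" by (metis ex_in_conv keys_eq_empty)
  then show thesis using p that[of n] by (auto simp: mono_ideal_def homogeneous_def)
qed

text \<open>The lower bound is the weighted inequality on the ground set. It is met up to rounding
  by the exponents \<open>2 * Z\<close> at \<open>Pa\<close> and \<open>Pc\<close> and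
  \<open>Z\<close> elsewhere, with \<open>Z\<close> just above \<open>s / k\<close>: each
  circuit-hyperplane contains exactly one of \<open>Pa\<close> and \<open>Pc\<close>, so its weight
  is \<open>k * Z\<close>, and the total is \<open>(2 * k + 1) * Z\<close>.\<close>

lemma alpha_symbolic_power_M_matroid:
  assumes k: "k \<ge> 5"
  defines "\<alpha> s \<equiv> alpha (symbolic_power (poly_ring (ground (M_matroid k))) (facet_ideal (M_matroid k) :: (elt, 'a::field) mpoly set) s)"
  shows "(2 * real k + 1) * real s \<le> real k * real (\<alpha> s)" "real k * real (\<alpha> s) \<le> (2 * real k + 1) * (real s + real k)"
proof -
  note E = card_E_set[OF k]
  define Z where "Z = s div k + 1"
  define f where "f v = (if v = Pa \<or> v = Pc then 2 * Z else Z)" for v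
  have f: "f Pa = 2 * Z" "f Pb = Z" "f Pc = 2 * Z" "\<And>j. f (Num j) = Z" by (simp_all add: f_def)
  have "s = k * (s div k) + s mod k" by simp
  moreover have "s mod k < k" using k by simp
  ultimately have Z: "s \<le> k * Z" unfolding Z_def distrib_left by linarith
  have kZ: "2 * Z + (k - 2) * Z = k * Z" "2 * Z + Z + (k - 3) * Z = k * Z"
  proof -
    have "k = (k - 3) + 3" using k by simp
    then obtain j where "k = j + 3" by blast
    then show "2 * Z + (k - 2) * Z = k * Z" "2 * Z + Z + (k - 3) * Z = k * Z" by (simp_all add: algebra_simps)
  qed
  have sv: "symbolic_vector k s f"
    unfolding symbolic_vector_def
  proof (intro conjI allI impI)
    fix i assume "i \<le> k - 1"
    then consider "i \<le> k - 3" | "i = k - 2" | "i = k - 1" by linarith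
    then show "s \<le> sum f (C_set k i)"
    proof cases
      case 1
      have "sum f (C_set k i) = 2 * Z + Z + (k - 3) * Z"
        unfolding sum_C_set(1)[OF k 1] f by (simp add: X_set_range(2)[OF k])
      then show ?thesis using Z kZ(2) by (simp only:)
    next
      case 2
      have "sum f (C_set k i) = 2 * Z + (k - 2) * Z" unfolding 2 sum_C_set(2)[OF k] f by (simp add: card_parity_class[OF k])
      then show ?thesis using Z kZ(1) by (simp only:)
    next
      case 3
      have "sum f (C_set k i) = 2 * Z + (k - 2) * Z" unfolding 3 sum_C_set(3)[OF k] f by (simp add: card_parity_class[OF k])
      then show ?thesis using Z kZ(1) by (simp only:)
    qed
  next
    fix U assume U: "U \<subseteq> E_set k" "card U = k"
    have "of_nat (card U) * Z \<le> sum f U" by (rule sum_bounded_below) (simp add: f_def)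
    then show "s \<le> sum f U" using U(2) Z by simp
  qed
  let ?A = "{m. symbolic_vector k s (Poly_Mapping.lookup m)}" and ?m = "vector_monom (E_set k) f"
  have mA: "?m \<in> ?A" "Poly_Mapping.keys ?m \<subseteq> E_set k"
    using sv keys_vector_monom[of "E_set k" f] E by (simp_all add: symbolic_vector_monom[OF k])
  have \<alpha>: "\<alpha> s = alpha (mono_ideal (E_set k) ?A :: (elt, 'a) mpoly set)"
    unfolding \<alpha>_def symbolic_power_M_matroid[OF k] ..
  obtain n where n: "symbolic_vector k s (Poly_Mapping.lookup n)" "Poly_Mapping.keys n \<subseteq> E_set k" "mono_degree n = \<alpha> s"
    using alpha_mono_ideal_attained[OF mA] unfolding \<alpha> by blast
  have "(2 * real k + 1) * real s \<le> real k * (\<Sum>v\<in>E_set k. real (Poly_Mapping.lookup n v))"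
    by (rule sum_E_set_lower[OF k symbolic_vector_real[OF n(1)]])
  also have "(\<Sum>v\<in>E_set k. real (Poly_Mapping.lookup n v)) = real (\<alpha> s)"
    using mono_degree_eq[of "E_set k" n] n E by simp
  finally show "(2 * real k + 1) * real s \<le> real k * real (\<alpha> s)" .
  have "\<alpha> s \<le> mono_degree ?m" unfolding \<alpha> by (rule alpha_mono_ideal_le[OF mA])
  also have "\<dots> = sum f (E_set k)"
    using mono_degree_eq[OF _ mA(2)] msum_vector_monom[of "E_set k" "E_set k" f] E by simp
  also have "\<dots> = (2 * k + 1) * Z"
  proof -
    have "2 * k + 1 = 5 + (2 * k - 4)" using k by simp
    then show ?thesis by (simp only: add_mult_distrib sum_E_set f sum_constant card_atLeastAtMost) simp
  qed
  finally have "real (\<alpha> s) \<le> (2 * real k + 1) * real Z"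
    by (metis (no_types, opaque_lifting) of_nat_1 of_nat_add of_nat_le_iff of_nat_mult of_nat_numeral)
  then have "real k * real (\<alpha> s) \<le> (2 * real k + 1) * (real k * real Z)"
    using mult_left_mono[of "real (\<alpha> s)" "(2 * real k + 1) * real Z" "real k"] by (simp add: algebra_simps)
  also have "real k * real Z \<le> real s + real k"
  proof -
    have "k * (s div k) \<le> s" by (rule times_div_less_eq_dividend)
    then have "real (k * (s div k)) \<le> real s" by (simp only: of_nat_le_iff)
    then show ?thesis by (simp add: Z_def algebra_simps)
  qed
  finally show "real k * real (\<alpha> s) \<le> (2 * real k + 1) * (real s + real k)" by simp
qed

text \<open>The two bounds on the initial degree, divided by \<open>k * s\<close>, squeeze the
  quotient; the rounding error becomes \<open>(2 * k + 1) / s\<close>.\<close>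

lemma waldschmidt_M_matroid:
  assumes k: "k \<ge> 5"
  shows "waldschmidt (poly_ring (ground (M_matroid k))) (facet_ideal (M_matroid k) :: (elt, 'a::field) mpoly set)
    = (2 * real k + 1) / real k"
  unfolding waldschmidt_def
proof (rule limI, rule tendsto_sandwich)
  let ?\<alpha> = "\<lambda>s. alpha (symbolic_power (poly_ring (ground (M_matroid k))) (facet_ideal (M_matroid k) :: (elt, 'a) mpoly set) s)"
  note bounds = alpha_symbolic_power_M_matroid[OF k, where 'a = 'a]
  have k0: "real k > 0" using k by simp
  show "\<forall>\<^sub>F s in sequentially. (2 * real k + 1) / real k \<le> real (?\<alpha> s) / real s"
    using eventually_gt_at_top[of 0]
  proof eventually_elim
    case (elim s)
    then show ?case using bounds(1)[of s] k0 by (simp add: field_simps)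
  qed
  show "\<forall>\<^sub>F s in sequentially. real (?\<alpha> s) / real s \<le> (2 * real k + 1) / real k + (2 * real k + 1) / real s"
    using eventually_gt_at_top[of 0]
  proof eventually_elim
    case (elim s)
    then show ?case using bounds(2)[of s] k0 by (simp add: field_simps)
  qed
  show "(\<lambda>s. (2 * real k + 1) / real k + (2 * real k + 1) / real s) \<longlonglongrightarrow> (2 * real k + 1) / real k"
    using tendsto_add[OF tendsto_const lim_const_over_n, of "(2 * real k + 1) / real k" "2 * real k + 1"] by simp
qed simp

theorem propositionB5:
  fixes k :: nat
    and S :: "(elt, 'a::field) mpoly ring"
    and I :: "(elt, 'a) mpoly set"
  assumes "k \<ge> 5"
    and "S = poly_ring (ground (M_matroid k))"
    and "I = facet_ideal (M_matroid k)"
  shows "asymptotic_resurgence S I = ereal ((real k - 1)\<^sup>2 / (2 * real k - 3))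
    \<and> (real k - 1)\<^sup>2 / (2 * real k - 3) > real k / waldschmidt S I"
proof
  show "asymptotic_resurgence S I = ereal ((real k - 1)\<^sup>2 / (2 * real k - 3))"
    unfolding assms(2,3) by (rule asymptotic_resurgence_M_matroid[OF assms(1)])
  have "real k / waldschmidt S I = (real k)\<^sup>2 / (2 * real k + 1)"
    unfolding assms(2,3) waldschmidt_M_matroid[OF assms(1)] by (simp add: power2_eq_square)
  also have "\<dots> < (real k - 1)\<^sup>2 / (2 * real k - 3)"
  proof -
    \<comment> \<open>The right side exceeds the left by exactly 1 for every \<open>k\<close>, so
      the inequality is strict but narrow.\<close>
    have "(real k)\<^sup>2 * (2 * real k - 3) < (real k - 1)\<^sup>2 * (2 * real k + 1)"
      by (simp add: power2_eq_square algebra_simps)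
    moreover have "2 * real k - 3 > 0" "2 * real k + 1 > 0" using assms(1) by simp_all
    ultimately show ?thesis by (simp add: divide_simps)
  qed
  finally show "real k / waldschmidt S I < (real k - 1)\<^sup>2 / (2 * real k - 3)" .
qed

end
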